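(* Let $\Omega$ be a Polish space, $\mathcal P$ a set of Borel probability measures on $\Omega$, $\mathbb B$ a separable Banach space, $U\subset\mathbb R^d$ open, and let $F:\Omega\times U\to\mathbb B$ be jointly Borel. Suppose that $z\mapsto F(x,z)$ is $C^1$ for every $x\in\Omega$, with jointly Borel derivative $D_zF$. Let $(K_R)_{R\ge1}$ be a compact capacity core for $\mathcal P$ and write $\tau_R=\sup_{P\in\mathcal P}P(K_R^c)$. Fix a compact set $C\subset U$ and $\rho>0$ such that $C_\rho:=\{z\in\mathbb R^d:\operatorname{dist}(z,C)\le\rho\}\subset U$. Assume that the first jet $(F,D_zF)$ is continuous on $K_R\times C_\rho$ for every $R$. Define $H_C(x):=\sup_{z\in C_\rho}\|D_zF(x,z)\|$ and suppose, for some $1\le p<q<\infty$, that $$M_q:=\sup_{P\in\mathcal P}\bigl(E^P[H_C^q]\bigr)^{1/q}<\infty.$$ For $0<\delta\le\rho$ put $$\omega_R(\delta):=\sup_{x\in K_R,\ z\in C,\ |u|\le\delta}\|D_zF(x,z+u)-D_zF(x,z)\|.$$ Then $\omega_R(\delta)\downarrow0$ as $\delta\downarrow0$, and for every $R$ and $0<\delta\le\rho$ $$\sup_{P\in\mathcal P,\ z\in C,\ 0<|h|\le\delta}\frac{\|F(\cdot,z+h)-F(\cdot,z)-D_zF(\cdot,z)h\|_{L^p(P;\mathbb B)}}{|h|}\le\omega_R(\delta)+2M_q\,\tau_R^{1/p-1/q}.$$ Consequently, $$\lim_{\delta\downarrow0}\ \sup_{P\in\mathcal P,\ z\in C,\ 0<|h|\le\delta}\frac{\|F(\cdot,z+h)-F(\cdot,z)-D_zF(\cdot,z)h\|_{L^p(P;\mathbb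 B)}}{|h|}=0.$$ Moreover, the derivative field $\mathscr D_C(x):=(D_zF(x,z))_{z\in C}\in C\bigl(C;\mathcal L(\mathbb R^d,\mathbb B)\bigr)$ is Borel and continuous on every $K_R$. If $P_n,P\in\mathcal P$ and $P_n\Rightarrow P$ weakly, then $$W_p\bigl(P_n\circ\mathscr D_C^{-1},P\circ\mathscr D_C^{-1}\bigr)\to0.$$ If, in addition, $$\sup_{P\in\mathcal P}E^P\Bigl[\sup_{z\in C}\bigl(\|F(\cdot,z)\|+\|D_zF(\cdot,z)\|\bigr)^q\Bigr]<\infty,$$ then the same conclusion (Borel measurability, continuity on every $K_R$, and $W_p$-convergence of the laws along $P_n\Rightarrow P$) holds for the first-jet field $\mathscr J_C(x):=(F(x,z),D_zF(x,z))_{z\in C}$. In both cases $W_p$ is computed from the supremum norm of the relevant field space.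
   Context: A compact capacity core for $\mathcal P$ is an increasing sequence of compact sets $(K_R)_{R\ge1}$ in $\Omega$ with $\sup_{P\in\mathcal P}P(K_R^c)\to0$ as $R\to\infty$. $W_p$ is the $p$-Wasserstein distance between laws with finite $p$-th moment, with respect to the metric induced by the indicated norm. *)

theory Defs
  imports "HOL-Probability.Probability"
begin

text \<open>
  Suprema, moments and distances are taken in \<^typ>\<open>ennreal\<close>, so that no supremum or integral
  is silently \<open>0\<close> when it should be infinite, and a supremum over the empty set is \<open>0\<close>.
\<close>

text \<open>Intended for exponents \<open>a > 0\<close> only (then \<open>0\<close> is sent to \<open>0\<close> and \<open>\<infinity>\<close> to \<open>\<infinity>\<close>).\<close>

definition enn_powr :: "ennreal \<Rightarrow> real \<Rightarrow> ennreal" where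
  "enn_powr x a = (if x = \<infinity> then \<infinity> else ennreal (enn2real x powr a))"

definition Lp_norm :: "real \<Rightarrow> 'a measure \<Rightarrow> ('a \<Rightarrow> 'b::real_normed_vector) \<Rightarrow> ennreal" where
  "Lp_norm p M f = enn_powr (\<integral>\<^sup>+x. ennreal (norm (f x) powr p) \<partial>M) (1 / p)"

definition borel_prob_measures :: "'a::topological_space measure set" where
  "borel_prob_measures = {P. prob_space P \<and> sets P = sets borel}"


subsection \<open>Capacity cores and weak convergence\<close>

definition core_defect :: "'a measure set \<Rightarrow> (nat \<Rightarrow> 'a set) \<Rightarrow> nat \<Rightarrow> ennreal" where
  "core_defect \<P> K R = (SUP P\<in>\<P>. emeasure P (- K R))"

text \<open>Only the members \<open>K R\<close> with \<open>R \<ge> 1\<close> matter; \<open>K 0\<close> is unconstrained.\<close>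

definition compact_capacity_core ::
    "'a::topological_space measure set \<Rightarrow> (nat \<Rightarrow> 'a set) \<Rightarrow> bool" where
  "compact_capacity_core \<P> K \<longleftrightarrow>
     (\<forall>R\<ge>1. compact (K R)) \<and> mono_on {1..} K \<and> core_defect \<P> K \<longlonglongrightarrow> 0"

definition weakly_converges ::
    "(nat \<Rightarrow> 'a::topological_space measure) \<Rightarrow> 'a measure \<Rightarrow> bool" where
  "weakly_converges Pn P \<longleftrightarrow>
     (\<forall>g::'a \<Rightarrow> real. continuous_on UNIV g \<and> bounded (range g) \<longrightarrow>
        (\<lambda>n. \<integral>x. g x \<partial>Pn n) \<longlonglongrightarrow> (\<integral>x. g x \<partial>P))"


subsection \<open>Wasserstein distance on an abstract metric space\<close>

definition borel_of :: "'a topology \<Rightarrow> 'a measure" where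
  "borel_of X = sigma (topspace X) {S. openin X S}"

definition metric_borel :: "'a metric \<Rightarrow> 'a measure" where
  "metric_borel m = borel_of (mtopology_of m)"

definition couplings :: "'a measure \<Rightarrow> 'a measure \<Rightarrow> ('a \<times> 'a) measure set" where
  "couplings \<mu> \<nu> =
     {\<pi>. prob_space \<pi> \<and> sets \<pi> = sets (\<mu> \<Otimes>\<^sub>M \<nu>) \<and> distr \<pi> \<mu> fst = \<mu> \<and> distr \<pi> \<nu> snd = \<nu>}"

definition wasserstein :: "'a metric \<Rightarrow> real \<Rightarrow> 'a measure \<Rightarrow> 'a measure \<Rightarrow> ennreal" where
  "wasserstein m p \<mu> \<nu> =
     enn_powr (INF \<pi>\<in>couplings \<mu> \<nu>. \<integral>\<^sup>+(x, y). ennreal (mdist m x y powr p) \<partial>\<pi>) (1 / p)"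

definition finite_moment :: "'a metric \<Rightarrow> real \<Rightarrow> 'a measure \<Rightarrow> bool" where
  "finite_moment m p \<mu> \<longleftrightarrow>
     (\<exists>a\<in>mspace m. (\<integral>\<^sup>+x. ennreal (mdist m a x powr p) \<partial>\<mu>) < \<infinity>)"


subsection \<open>Objects attached to the random field\<close>

text \<open>
  \<^const>\<open>infdist\<close> is \<open>0\<close> for the empty set; the guard gives the usual convention
  that the distance to the empty set is infinite.
\<close>

definition closed_nbhd :: "'a::metric_space set \<Rightarrow> real \<Rightarrow> 'a set" where
  "closed_nbhd C \<rho> = {z. C \<noteq> {} \<and> infdist z C \<le> \<rho>}"

definition derivative_envelope ::
    "('w \<Rightarrow> 'z::real_normed_vector \<Rightarrow> ('z \<Rightarrow>\<^sub>L 'b::real_normed_vector)) \<Rightarrow> 'z set \<Rightarrow> real \<Rightarrow> 'w \<Rightarrow> ennreal"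
  where "derivative_envelope DF C \<rho> x = (SUP z\<in>closed_nbhd C \<rho>. ennreal (norm (DF x z)))"

definition envelope_moment ::
    "'w measure set \<Rightarrow> ('w \<Rightarrow> 'z::real_normed_vector \<Rightarrow> ('z \<Rightarrow>\<^sub>L 'b::real_normed_vector)) \<Rightarrow>
     'z set \<Rightarrow> real \<Rightarrow> real \<Rightarrow> ennreal" where
  "envelope_moment \<P> DF C \<rho> q =
     (SUP P\<in>\<P>. enn_powr (\<integral>\<^sup>+x. enn_powr (derivative_envelope DF C \<rho> x) q \<partial>P) (1 / q))"

definition core_modulus ::
    "(nat \<Rightarrow> 'w set) \<Rightarrow> ('w \<Rightarrow> 'z::real_normed_vector \<Rightarrow> ('z \<Rightarrow>\<^sub>L 'b::real_normed_vector)) \<Rightarrow>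
     'z set \<Rightarrow> nat \<Rightarrow> real \<Rightarrow> ennreal" where
  "core_modulus K DF C R \<delta> =
     (SUP (x, z, u)\<in>K R \<times> C \<times> {u. norm u \<le> \<delta>}. ennreal (norm (DF x (z + u) - DF x z)))"

definition Lp_remainder ::
    "'w measure set \<Rightarrow> ('w \<Rightarrow> 'z::real_normed_vector \<Rightarrow> 'b::real_normed_vector) \<Rightarrow>
     ('w \<Rightarrow> 'z \<Rightarrow> ('z \<Rightarrow>\<^sub>L 'b)) \<Rightarrow> 'z set \<Rightarrow> real \<Rightarrow> real \<Rightarrow> ennreal" where
  "Lp_remainder \<P> F DF C p \<delta> =
     (SUP (P, z, h)\<in>\<P> \<times> C \<times> {h. 0 < norm h \<and> norm h \<le> \<delta>}.
        Lp_norm p P (\<lambda>x. F x (z + h) - F x z - blinfun_apply (DF x z) h) / ennreal (norm h))"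


subsection \<open>Field spaces\<close>

text \<open>
  A continuous function on \<open>C\<close> is represented by its extension by \<^const>\<open>undefined\<close>;
  \<^const>\<open>cfunspace\<close> carries the supremum metric.  The fibre of the first-jet space is normed by
  \<open>\<parallel>b\<parallel> + \<parallel>S\<parallel>\<close> (the norm occurring in the moment hypothesis on the first jet), not by the
  equivalent Euclidean norm that the product type has by default.
\<close>

definition jet_fibre_metric ::
    "('b::real_normed_vector \<times> ('z::real_normed_vector \<Rightarrow>\<^sub>L 'b)) metric" where
  "jet_fibre_metric = metric (UNIV, \<lambda>(b, S) (c, T). norm (b - c) + norm (S - T))"

lemma Metric_space_jet_fibre:
  "Metric_space UNIV (\<lambda>(b::'b::real_normed_vector, S::'z::real_normed_vector \<Rightarrow>\<^sub>L 'b) (c, T).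
     norm (b - c) + norm (S - T))"
proof -
  have tri: "norm (b - e) + norm (S - V) \<le> norm (b - c) + norm (S - T) + (norm (c - e) + norm (T - V))"
    for b c e :: 'b and S T V :: "'z \<Rightarrow>\<^sub>L 'b"
    using norm_triangle_ineq[of "b - c" "c - e"] norm_triangle_ineq[of "S - T" "T - V"] by simp
  show ?thesis
  proof
    show "(case x of (b, S) \<Rightarrow> \<lambda>(c, T). norm (b - c) + norm (S - T)) z
      \<le> (case x of (b, S) \<Rightarrow> \<lambda>(c, T). norm (b - c) + norm (S - T)) y
        + (case y of (b, S) \<Rightarrow> \<lambda>(c, T). norm (b - c) + norm (S - T)) z"
      for x y z :: "'b \<times> ('z \<Rightarrow>\<^sub>L 'b)"
      using tri by (simp split: prod.split)
  qed (auto simp: norm_minus_commute add_nonneg_eq_0_iff)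
qed

lemma mspace_jet_fibre_metric [simp]: "mspace jet_fibre_metric = UNIV"
  unfolding jet_fibre_metric_def
  by (rule Metric_space.mspace_metric[OF Metric_space_jet_fibre])

lemma mdist_jet_fibre_metric:
  "mdist jet_fibre_metric (b, S) (c, T) = norm (b - c) + norm (S - T)"
  unfolding jet_fibre_metric_def
  by (simp add: Metric_space.mdist_metric[OF Metric_space_jet_fibre])

definition derivative_field_space ::
    "'z::real_normed_vector set \<Rightarrow> ('z \<Rightarrow> ('z \<Rightarrow>\<^sub>L 'b::real_normed_vector)) metric" where
  "derivative_field_space C = cfunspace (top_of_set C) euclidean_metric"

definition jet_field_space ::
    "'z::real_normed_vector set \<Rightarrow> ('z \<Rightarrow> 'b::real_normed_vector \<times> ('z \<Rightarrow>\<^sub>L 'b)) metric" where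
  "jet_field_space C = cfunspace (top_of_set C) jet_fibre_metric"

definition derivative_field ::
    "('w \<Rightarrow> 'z::real_normed_vector \<Rightarrow> ('z \<Rightarrow>\<^sub>L 'b::real_normed_vector)) \<Rightarrow> 'z set \<Rightarrow>
     'w \<Rightarrow> 'z \<Rightarrow> ('z \<Rightarrow>\<^sub>L 'b)" where
  "derivative_field DF C x = (\<lambda>z\<in>C. DF x z)"

definition jet_field ::
    "('w \<Rightarrow> 'z::real_normed_vector \<Rightarrow> 'b::real_normed_vector) \<Rightarrow>
     ('w \<Rightarrow> 'z \<Rightarrow> ('z \<Rightarrow>\<^sub>L 'b)) \<Rightarrow> 'z set \<Rightarrow> 'w \<Rightarrow> 'z \<Rightarrow> 'b \<times> ('z \<Rightarrow>\<^sub>L 'b)" where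
  "jet_field F DF C x = (\<lambda>z\<in>C. (F x z, DF x z))"

definition law :: "'w measure \<Rightarrow> 'v metric \<Rightarrow> ('w \<Rightarrow> 'v) \<Rightarrow> 'v measure" where
  "law P m f = distr P (metric_borel m) f"

end

theory Submission
  imports Defs
begin

text \<open>
  The mean value inequality bounds the remainder at \<open>x\<close> by \<open>\<bar>h\<bar> \<omega>\<^sub>R(\<delta>)\<close> for \<open>x\<close> in \<open>K\<^sub>R\<close> and by
  \<open>2 \<bar>h\<bar> H\<^sub>C(x)\<close> elsewhere.  As these two contributions have disjoint supports, the \<open>L\<^sup>p\<close> norm of their sum
  needs no Minkowski inequality, and the second one is estimated by Hoelder's inequality on the
  complement of \<open>K\<^sub>R\<close>.

  For the Wasserstein convergence, cover \<open>K\<^sub>R\<close> by finitely many balls on which the field oscillates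
  little, and take a continuous partition of unity on \<open>K\<^sub>R\<close> subordinate to them.  Weak convergence gives
  convergence of the masses of the pieces, so \<open>P\<^sub>n\<close> and \<open>P\<close> have a coupling that, up to mass of
  order \<open>\<tau>\<^sub>R\<close>, matches points of \<open>K\<^sub>R\<close> lying in a common ball.  The exceptional set costs little by
  Hoelder's inequality and the \<open>q\<close>-th moment bound.
\<close>

subsection \<open>Powers and integrals of extended nonnegative reals\<close>

text \<open>The Borel structure of the field space shapes the Wasserstein part. That space carries
  an abstract metric, and no measurability of its distance on a product is used. Couplings are
  therefore built on \<Omega>, where the product of the Borel sigma-algebras is again Borel, and
  only then pushed forward. Distances between fields are majorised by suprema over C of real
  functions; these are measurable because continuity in z reduces them to a countable dense set. The
  metric on the fibre is kept as a parameter, so that the derivative field and the first-jet field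
  are two instances of one argument.

  In the remainder bound, the constant 2 comes from the triangle inequality for D_zF(x,z+u) -
  D_zF(x,z), both terms being at most H_C(x). The exponent 1/p - 1/q is (1 - p/q)/p: Hoelder with
  exponent q/p leaves the power 1 - p/q of the mass off the core, and the p-th root is taken
  afterwards.\<close>

lemma enn_powr_ennreal: "0 \<le> x \<Longrightarrow> enn_powr (ennreal x) a = ennreal (x powr a)"
  by (simp add: enn_powr_def)

lemma enn_powr_top [simp]: "enn_powr \<top> a = \<top>"
  by (simp add: enn_powr_def)

lemma enn_powr_0 [simp]: "enn_powr 0 a = 0"
  by (simp add: enn_powr_def)

lemma enn_powr_1 [simp]: "enn_powr x 1 = x"
  by (cases x) (auto simp: enn_powr_ennreal)

lemma enn_powr_eq_0_iff [simp]: "enn_powr x a = 0 \<longleftrightarrow> x = 0"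
  by (cases x) (auto simp: enn_powr_ennreal)

lemma enn_powr_less_top_iff [simp]: "enn_powr x a < \<top> \<longleftrightarrow> x < \<top>"
  by (cases x) (auto simp: enn_powr_ennreal)

lemma enn_powr_mono:
  assumes "x \<le> y" "0 \<le> a" shows "enn_powr x a \<le> enn_powr y a"
  using assms by (cases x; cases y) (auto simp: enn_powr_ennreal powr_mono2 top_unique)

lemma ennreal_powr_le_enn_powr:
  assumes "ennreal d \<le> b" "0 \<le> d" "0 < p"
  shows "ennreal (d powr p) \<le> enn_powr b p"
  using enn_powr_mono[OF assms(1), of p] assms by (simp add: enn_powr_ennreal)

lemma enn_powr_mult:
  "enn_powr (x * y) a = enn_powr x a * enn_powr y a"
  by (cases x; cases y)
     (auto simp: enn_powr_ennreal powr_mult ennreal_mult_top ennreal_top_mult simp flip: ennreal_mult)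

lemma enn_powr_powr: "enn_powr (enn_powr x a) b = enn_powr x (a * b)"
  by (cases x) (auto simp: enn_powr_ennreal powr_powr)

text \<open>Writing \<open>r powr a = r * r powr (a - 1)\<close> and enlarging both second factors
  to \<open>(s + t) powr (a - 1)\<close> gives the inequality. It merges the integral over the core
  and the integral off the core into one p-th power before the root is taken, so that no constant is
  lost.\<close>

lemma enn_powr_superadditive:
  assumes "1 \<le> a" shows "enn_powr x a + enn_powr y a \<le> enn_powr (x + y) a"
proof (cases x; cases y)
  fix s t :: real assume st: "0 \<le> s" "x = ennreal s" "0 \<le> t" "y = ennreal t"
  have split: "r powr a = r * r powr (a - 1)" if "0 \<le> r" for r :: real
    using that assms by (simp add: powr_mult_base)
  have "s powr a + t powr a \<le> s * (s + t) powr (a - 1) + t * (s + t) powr (a - 1)"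
    unfolding split[OF \<open>0 \<le> s\<close>] split[OF \<open>0 \<le> t\<close>]
    using st assms by (intro add_mono mult_left_mono powr_mono2) auto
  also have "\<dots> = (s + t) powr a"
    using st split[of "s + t"] by (simp add: algebra_simps)
  finally show ?thesis
    using st by (simp add: enn_powr_ennreal flip: ennreal_plus)
qed auto

text \<open>The constant comes from x + y \<le> 2 max(x, y). Any finite constant serves, since it
  multiplies a quantity that tends to 0.\<close>

lemma enn_powr_add_le:
  assumes "0 < a" shows "enn_powr (x + y) a \<le> enn_powr 2 a * (enn_powr x a + enn_powr y a)"
proof -
  have "x + y \<le> 2 * max x y"
    by (simp add: mult_2 add_mono)
  then have "enn_powr (x + y) a \<le> enn_powr 2 a * enn_powr (max x y) a"
    using assms enn_powr_mono[of "x + y" "2 * max x y" a] by (simp add: enn_powr_mult)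
  also have "\<dots> \<le> enn_powr 2 a * (enn_powr x a + enn_powr y a)"
    by (intro mult_left_mono) (auto simp: max_def)
  finally show ?thesis .
qed

lemma measurable_enn_powr [measurable]: "(\<lambda>x. enn_powr x a) \<in> borel_measurable borel"
  unfolding enn_powr_def by measurable

lemma tendsto_enn_powr_0:
  assumes "(f \<longlongrightarrow> 0) F" "0 < a" shows "((\<lambda>x. enn_powr (f x) a) \<longlongrightarrow> 0) F"
proof (rule order_tendstoI)
  fix e :: ennreal assume "0 < e"
  \<comment> \<open>The power 1/a is the monotone inverse of the power a, so the threshold for
    \<open>f x\<close> is the preimage of \<open>e\<close>.\<close>
  have "enn_powr (f x) a < e" if "f x < enn_powr e (1 / a)" for x
    using that \<open>0 < a\<close> enn_powr_mono[of e "enn_powr (f x) a" "1 / a"]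
    by (force simp: enn_powr_powr not_le[symmetric])
  moreover have "eventually (\<lambda>x. f x < enn_powr e (1 / a)) F"
    using assms(1) \<open>0 < e\<close> by (intro order_tendstoD) (auto simp: zero_less_iff_neq_zero)
  ultimately show "eventually (\<lambda>x. enn_powr (f x) a < e) F"
    by (auto elim: eventually_mono)
qed auto

lemma enn_young:
  assumes "0 < \<theta>" "\<theta> < 1"
  shows "enn_powr x \<theta> * enn_powr y (1 - \<theta>) \<le> ennreal \<theta> * x + ennreal (1 - \<theta>) * y"
proof (cases "x = 0 \<or> y = 0 \<or> x = \<top> \<or> y = \<top>")
  case True
  then show ?thesis using assms by (auto simp: ennreal_mult_top)
next
  case False
  then obtain s t where "x = ennreal s" "y = ennreal t" "s > 0" "t > 0"
    by (cases x; cases y) (auto simp: less_le)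
  then show ?thesis
    using Youngs_inequality_0[of \<theta> "1 - \<theta>" s t] assms
    by (simp add: enn_powr_ennreal flip: ennreal_mult ennreal_plus)
qed

text \<open>This is Hoelder's inequality for the product of \<open>h^p\<close> and the indicator of
  A, with exponent q/p and its conjugate. After both integrals are normalised to 1, Young's
  inequality with \<theta> = p/q holds pointwise and is integrated. Infinite values of h and an
  infinite q-th moment are allowed, so later uses need no integrability side conditions.\<close>

lemma nn_integral_enn_powr_set_le:
  assumes h [measurable]: "h \<in> borel_measurable M" and A [measurable]: "A \<in> sets M"
    and A_fin: "emeasure M A < \<infinity>" and pq: "0 < p" "p < q"
  shows "(\<integral>\<^sup>+x. enn_powr (h x) p * indicator A x \<partial>M)
    \<le> enn_powr (\<integral>\<^sup>+x. enn_powr (h x) q \<partial>M) (p / q) * enn_powr (emeasure M A) (1 - p / q)"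
proof -
  define X where "X = (\<integral>\<^sup>+x. enn_powr (h x) q \<partial>M)"
  define Y where "Y = emeasure M A"
  define \<theta> where "\<theta> = p / q"
  have \<theta>: "0 < \<theta>" "\<theta> < 1" using pq by (auto simp: \<theta>_def)
  \<comment> \<open>The normalisation divides by X and Y. If either is 0 the integrand vanishes
    almost everywhere; if X is infinite and Y is not 0, the right-hand side is infinite.\<close>
  consider "X = 0" | "Y = 0" | "X = \<top>" "Y \<noteq> 0" | "X \<noteq> 0" "Y \<noteq> 0" "X \<noteq> \<top>" by blast
  then have "(\<integral>\<^sup>+x. enn_powr (h x) p * indicator A x \<partial>M) \<le> enn_powr X \<theta> * enn_powr Y (1 - \<theta>)"
  proof cases
    case 1
    then have "AE x in M. enn_powr (h x) q = 0"
      by (subst (asm) X_def, subst (asm) nn_integral_0_iff_AE) auto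
    then have "AE x in M. enn_powr (h x) p * indicator A x = 0" by eventually_elim simp
    then show ?thesis by (subst nn_integral_0_iff_AE[THEN iffD2]) auto
  next
    case 2
    then have "AE x in M. x \<notin> A" by (auto simp: Y_def intro!: AE_not_in null_setsI)
    then have "AE x in M. enn_powr (h x) p * indicator A x = 0" by eventually_elim simp
    then show ?thesis by (subst nn_integral_0_iff_AE[THEN iffD2]) auto
  next
    case 3
    then show ?thesis by (simp add: ennreal_top_mult)
  next
    case 4
    have Y: "Y \<noteq> \<top>" using A_fin by (simp add: Y_def)
    have cancel: "Z * (w / Z) = w" if "Z \<noteq> 0" "Z \<noteq> \<top>" for Z w :: ennreal
      using that by (metis ennreal_times_divide ennreal_mult_divide_eq mult.commute)
    define c where "c = enn_powr X \<theta> * enn_powr Y (1 - \<theta>)"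
    have pw: "enn_powr (h x) p * indicator A x
        \<le> c * (ennreal \<theta> * (enn_powr (h x) q / X) + ennreal (1 - \<theta>) * (indicator A x / Y))" for x
    proof -
      have "enn_powr (h x) p * indicator A x = enn_powr (enn_powr (h x) q) \<theta> * enn_powr (indicator A x) (1 - \<theta>)"
        using pq by (auto simp: enn_powr_powr \<theta>_def indicator_def enn_powr_ennreal[of 1, simplified])
      also have "\<dots> = enn_powr (X * (enn_powr (h x) q / X)) \<theta> * enn_powr (Y * (indicator A x / Y)) (1 - \<theta>)"
        using 4 Y by (simp add: cancel)
      also have "\<dots> = c * (enn_powr (enn_powr (h x) q / X) \<theta> * enn_powr (indicator A x / Y) (1 - \<theta>))"
        by (simp add: enn_powr_mult c_def ac_simps)
      also have "\<dots> \<le> c * (ennreal \<theta> * (enn_powr (h x) q / X) + ennreal (1 - \<theta>) * (indicator A x / Y))"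
        by (intro mult_left_mono enn_young \<theta>) auto
      finally show ?thesis .
    qed
    have "(\<integral>\<^sup>+x. enn_powr (h x) p * indicator A x \<partial>M)
      \<le> (\<integral>\<^sup>+x. c * (ennreal \<theta> * (enn_powr (h x) q / X) + ennreal (1 - \<theta>) * (indicator A x / Y)) \<partial>M)"
      by (intro nn_integral_mono pw)
    also have "\<dots> = c * (ennreal \<theta> * (X / X) + ennreal (1 - \<theta>) * (Y / Y))"
      by (simp add: nn_integral_cmult nn_integral_add nn_integral_divide X_def Y_def)
    also have "\<dots> = c"
      using 4 Y \<theta> by (simp add: ennreal_divide_self less_top flip: ennreal_plus)
    finally show ?thesis by (simp add: c_def)
  qed
  then show ?thesis by (simp add: X_def Y_def \<theta>_def)
qed

text \<open>
  Without measurability of \<open>f\<close>: the distance of a metric space need not be measurable for the product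
  of the two Borel sigma-algebras.
\<close>

lemma nn_integral_distr_le:
  assumes [measurable]: "T \<in> measurable M N"
  shows "nn_integral (distr M N T) f \<le> (\<integral>\<^sup>+x. f (T x) \<partial>M)"
  unfolding nn_integral_def[of "distr M N T"]
proof (rule SUP_least, clarify)
  fix g assume g: "simple_function (distr M N T) g" "g \<le> f"
  then have [measurable]: "g \<in> borel_measurable N"
    using borel_measurable_simple_function by fastforce
  have "integral\<^sup>S (distr M N T) g = (\<integral>\<^sup>+x. g x \<partial>distr M N T)"
    using g by (simp add: nn_integral_eq_simple_integral)
  also have "\<dots> = (\<integral>\<^sup>+x. g (T x) \<partial>M)"
    by (simp add: nn_integral_distr)
  also have "\<dots> \<le> (\<integral>\<^sup>+x. f (T x) \<partial>M)"
    using g by (intro nn_integral_mono) (auto simp: le_fun_def)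
  finally show "integral\<^sup>S (distr M N T) g \<le> (\<integral>\<^sup>+x. f (T x) \<partial>M)" .
qed

subsection \<open>Couplings\<close>

text \<open>By Tonelli, integrating out one variable leaves the density of the marginal, which is 1
  almost everywhere. Total mass 1 is then inherited from the first marginal.\<close>

lemma density_in_couplings:
  assumes "prob_space M" "prob_space N"
    and f [measurable]: "f \<in> borel_measurable (M \<Otimes>\<^sub>M N)"
    and fst_marginal: "AE x in M. (\<integral>\<^sup>+y. f (x, y) \<partial>N) = 1"
    and snd_marginal: "AE y in N. (\<integral>\<^sup>+x. f (x, y) \<partial>M) = 1"
  shows "density (M \<Otimes>\<^sub>M N) f \<in> couplings M N"
proof -
  interpret M: prob_space M by fact
  interpret N: prob_space N by fact
  interpret pair_prob_space M N ..
  let ?\<pi> = "density (M \<Otimes>\<^sub>M N) f"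
  have fst: "distr ?\<pi> M fst = M"
  proof (rule measure_eqI)
    fix A assume "A \<in> sets (distr ?\<pi> M fst)"
    then have A [measurable]: "A \<in> sets M" by simp
    have "emeasure (distr ?\<pi> M fst) A = emeasure ?\<pi> (fst -` A \<inter> space (M \<Otimes>\<^sub>M N))"
      by (subst emeasure_distr) auto
    also have "\<dots> = (\<integral>\<^sup>+z. f z * indicator A (fst z) \<partial>(M \<Otimes>\<^sub>M N))"
      by (subst emeasure_density) (auto intro!: nn_integral_cong split: split_indicator)
    also have "\<dots> = (\<integral>\<^sup>+x. (\<integral>\<^sup>+y. f (x, y) \<partial>N) * indicator A x \<partial>M)"
      by (subst N.nn_integral_fst[symmetric]) (auto intro!: nn_integral_cong nn_integral_multc)
    also have "\<dots> = (\<integral>\<^sup>+x. indicator A x \<partial>M)"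
      using fst_marginal by (intro nn_integral_cong_AE) auto
    finally show "emeasure (distr ?\<pi> M fst) A = emeasure M A" by simp
  qed simp
  have snd: "distr ?\<pi> N snd = N"
  proof (rule measure_eqI)
    fix A assume "A \<in> sets (distr ?\<pi> N snd)"
    then have A [measurable]: "A \<in> sets N" by simp
    have "emeasure (distr ?\<pi> N snd) A = emeasure ?\<pi> (snd -` A \<inter> space (M \<Otimes>\<^sub>M N))"
      by (subst emeasure_distr) auto
    also have "\<dots> = (\<integral>\<^sup>+z. f z * indicator A (snd z) \<partial>(M \<Otimes>\<^sub>M N))"
      by (subst emeasure_density) (auto intro!: nn_integral_cong split: split_indicator)
    also have "\<dots> = (\<integral>\<^sup>+y. (\<integral>\<^sup>+x. f (x, y) \<partial>M) * indicator A y \<partial>N)"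
      by (subst nn_integral_snd[symmetric]) (auto intro!: nn_integral_cong nn_integral_multc)
    also have "\<dots> = (\<integral>\<^sup>+y. indicator A y \<partial>N)"
      using snd_marginal by (intro nn_integral_cong_AE) auto
    finally show "emeasure (distr ?\<pi> N snd) A = emeasure N A" by simp
  qed simp
  have "prob_space (distr ?\<pi> M fst)" by (simp add: fst M.prob_space_axioms)
  then have "prob_space ?\<pi>"
    by (rule prob_space_distrD[rotated]) simp
  then show ?thesis by (simp add: couplings_def fst snd)
qed

text \<open>
  The density couples the parts of \<open>M\<close> and \<open>N\<close> weighted by \<open>\<phi> t\<close> and \<open>\<psi> t\<close> independently, keeping
  the common mass \<open>min\<close>, and couples the remainders, of mass \<open>s\<close> each, independently.  If \<open>s = 0\<close>
  the remainders vanish almost everywhere and division by zero does no harm.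
\<close>

lemma partition_coupling:
  fixes \<phi> :: "'t \<Rightarrow> 'a \<Rightarrow> real" and \<psi> :: "'t \<Rightarrow> 'a \<Rightarrow> real"
  assumes "prob_space M" "prob_space N" and T: "finite T"
    and \<phi>_meas [measurable]: "\<And>t. t \<in> T \<Longrightarrow> \<phi> t \<in> borel_measurable M"
    and \<psi>_meas [measurable]: "\<And>t. t \<in> T \<Longrightarrow> \<psi> t \<in> borel_measurable N"
    and \<phi>0: "\<And>t x. t \<in> T \<Longrightarrow> 0 \<le> \<phi> t x" and \<phi>1: "\<And>x. (\<Sum>t\<in>T. \<phi> t x) \<le> 1"
    and \<psi>0: "\<And>t y. t \<in> T \<Longrightarrow> 0 \<le> \<psi> t y" and \<psi>1: "\<And>y. (\<Sum>t\<in>T. \<psi> t y) \<le> 1"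
    and D [measurable]: "D \<in> sets (M \<Otimes>\<^sub>M N)"
    and off: "\<And>t x y. (x, y) \<in> D \<Longrightarrow> t \<in> T \<Longrightarrow> \<phi> t x * \<psi> t y = 0"
  shows "\<exists>\<pi>\<in>couplings M N.
    emeasure \<pi> D \<le> ennreal (1 - (\<Sum>t\<in>T. min (\<integral>x. \<phi> t x \<partial>M) (\<integral>y. \<psi> t y \<partial>N)))"
proof -
  interpret M: prob_space M by fact
  interpret N: prob_space N by fact
  interpret pair_prob_space M N ..
  define a where "a t = (\<integral>x. \<phi> t x \<partial>M)" for t
  define b where "b t = (\<integral>y. \<psi> t y \<partial>N)" for t
  define w where "w t = min (a t) (b t)" for t
  define s where "s = 1 - (\<Sum>t\<in>T. w t)"
  \<comment> \<open>\<open>u\<close> and \<open>v\<close> are the densities of the two marginals of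
    the matched part; the residual part has to supply 1 - u and 1 - v.\<close>
  define u where "u x = (\<Sum>t\<in>T. w t / a t * \<phi> t x)" for x
  define v where "v y = (\<Sum>t\<in>T. w t / b t * \<psi> t y)" for y
  have [measurable]: "u \<in> borel_measurable M" "v \<in> borel_measurable N"
    unfolding u_def v_def by measurable
  have \<phi>_le: "\<phi> t x \<le> 1" if "t \<in> T" for t x
    using member_le_sum[of t T "\<lambda>t. \<phi> t x"] T \<phi>0 \<phi>1[of x] that by fastforce
  have \<psi>_le: "\<psi> t y \<le> 1" if "t \<in> T" for t y
    using member_le_sum[of t T "\<lambda>t. \<psi> t y"] T \<psi>0 \<psi>1[of y] that by fastforce
  have int\<phi> [simp]: "integrable M (\<phi> t)" if "t \<in> T" for t
    using that \<phi>0 \<phi>_le by (intro M.integrable_const_bound[where B = 1]) auto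
  have int\<psi> [simp]: "integrable N (\<psi> t)" if "t \<in> T" for t
    using that \<psi>0 \<psi>_le by (intro N.integrable_const_bound[where B = 1]) auto
  have a0: "0 \<le> a t" and b0: "0 \<le> b t" if "t \<in> T" for t
    using that \<phi>0 \<psi>0 by (auto simp: a_def b_def)
  \<comment> \<open>If \<open>a t\<close> or \<open>b t\<close> is 0, then so is their minimum
    \<open>w t\<close>. Hence these identities, and those for \<open>w t / (a t * b t)\<close>
    below, survive the convention that division by 0 gives 0.\<close>
  have w0: "0 \<le> w t" and wa: "w t / a t \<le> 1" "w t / a t * a t = w t" "0 \<le> w t / a t"
    and wb: "w t / b t \<le> 1" "w t / b t * b t = w t" "0 \<le> w t / b t" if "t \<in> T" for t
    using a0[OF that] b0[OF that] by (auto simp: w_def divide_le_eq_1 min_def)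
  have u01: "0 \<le> u x" "u x \<le> 1" for x
  proof -
    show "0 \<le> u x"
      unfolding u_def by (rule sum_nonneg) (rule mult_nonneg_nonneg[OF wa(3) \<phi>0])
    have "u x \<le> (\<Sum>t\<in>T. \<phi> t x)"
      unfolding u_def using wa \<phi>0 by (intro sum_mono mult_left_le_one_le) auto
    then show "u x \<le> 1" using \<phi>1[of x] by simp
  qed
  have v01: "0 \<le> v y" "v y \<le> 1" for y
  proof -
    show "0 \<le> v y"
      unfolding v_def by (rule sum_nonneg) (rule mult_nonneg_nonneg[OF wb(3) \<psi>0])
    have "v y \<le> (\<Sum>t\<in>T. \<psi> t y)"
      unfolding v_def using wb \<psi>0 by (intro sum_mono mult_left_le_one_le) auto
    then show "v y \<le> 1" using \<psi>1[of y] by simp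
  qed
  have intu [simp]: "integrable M u" and intv [simp]: "integrable N v"
    unfolding u_def v_def by auto
  have "(\<integral>x. u x \<partial>M) = (\<Sum>t\<in>T. w t)"
    unfolding u_def using wa by (simp add: a_def)
  then have iu: "(\<integral>x. 1 - u x \<partial>M) = s"
    by (simp add: s_def M.prob_space)
  have "(\<integral>y. v y \<partial>N) = (\<Sum>t\<in>T. w t)"
    unfolding v_def using wb by (simp add: b_def)
  then have iv: "(\<integral>y. 1 - v y \<partial>N) = s"
    by (simp add: s_def N.prob_space)
  have s0: "0 \<le> s"
    unfolding iu[symmetric] using u01 by (intro Bochner_Integration.integral_nonneg) simp
  define r where "r x y = (1 - u x) * (1 - v y) / s" for x y
  define f where "f z = (\<Sum>t\<in>T. w t / (a t * b t) * \<phi> t (fst z) * \<psi> t (snd z)) + r (fst z) (snd z)" for z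
  have r0: "0 \<le> r x y" for x y
    using u01 v01 s0 by (simp add: r_def)
  have f0: "0 \<le> f z" for z
    unfolding f_def using w0 a0 b0 \<phi>0 \<psi>0 r0 by (intro add_nonneg_nonneg sum_nonneg) auto
  have f_meas [measurable]: "f \<in> borel_measurable (M \<Otimes>\<^sub>M N)"
    unfolding f_def r_def by measurable
  have wab: "w t / (a t * b t) * b t = w t / a t" "w t / (a t * b t) * a t = w t / b t" if "t \<in> T" for t
    using a0[OF that] b0[OF that] by (auto simp: w_def min_def)
  have "AE x in M. (1 - u x) * (s / s) = 1 - u x"
  proof (cases "s = 0")
    case True
    then have "AE x in M. 1 - u x = 0"
      using iu u01 by (subst integral_nonneg_eq_0_iff_AE[symmetric]) auto
    then show ?thesis by eventually_elim simp
  qed simp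
  then have m1: "AE x in M. (\<integral>\<^sup>+y. ennreal (f (x, y)) \<partial>N) = 1"
  proof eventually_elim
    case (elim x)
    have int: "integrable N (\<lambda>y. f (x, y))"
      unfolding f_def r_def by (auto intro!: integrable_add integrable_sum)
    have "(\<integral>y. f (x, y) \<partial>N) = (\<Sum>t\<in>T. w t / (a t * b t) * b t * \<phi> t x) + (1 - u x) * (s / s)"
      unfolding f_def r_def using iv
      by (subst Bochner_Integration.integral_add) (auto simp: b_def intro!: sum.cong)
    also have "(\<Sum>t\<in>T. w t / (a t * b t) * b t * \<phi> t x) = u x"
      unfolding u_def by (rule sum.cong) (simp_all only: wab)
    also have "u x + (1 - u x) * (s / s) = 1"
      unfolding elim by simp
    finally show ?case using int f0 by (simp add: nn_integral_eq_integral)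
  qed
  have "AE y in N. (1 - v y) * (s / s) = 1 - v y"
  proof (cases "s = 0")
    case True
    then have "AE y in N. 1 - v y = 0"
      using iv v01 by (subst integral_nonneg_eq_0_iff_AE[symmetric]) auto
    then show ?thesis by eventually_elim simp
  qed simp
  then have m2: "AE y in N. (\<integral>\<^sup>+x. ennreal (f (x, y)) \<partial>M) = 1"
  proof eventually_elim
    case (elim y)
    have int: "integrable M (\<lambda>x. f (x, y))"
      unfolding f_def r_def by (auto intro!: integrable_add integrable_sum)
    have "(\<integral>x. f (x, y) \<partial>M) = (\<Sum>t\<in>T. w t / (a t * b t) * a t * \<psi> t y) + (1 - v y) * (s / s)"
      unfolding f_def r_def using iu
      by (subst Bochner_Integration.integral_add) (auto simp: a_def intro!: sum.cong)
    also have "(\<Sum>t\<in>T. w t / (a t * b t) * a t * \<psi> t y) = v y"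
      unfolding v_def by (rule sum.cong) (simp_all only: wab)
    also have "v y + (1 - v y) * (s / s) = 1"
      unfolding elim by simp
    finally show ?case using int f0 by (simp add: nn_integral_eq_integral)
  qed
  let ?\<pi> = "density (M \<Otimes>\<^sub>M N) (\<lambda>z. ennreal (f z))"
  have "?\<pi> \<in> couplings M N"
    using m1 m2 by (intro density_in_couplings assms) auto
  moreover have "emeasure ?\<pi> D \<le> ennreal s"
  proof -
    have "emeasure ?\<pi> D = (\<integral>\<^sup>+z. ennreal (f z) * indicator D z \<partial>(M \<Otimes>\<^sub>M N))"
      by (simp add: emeasure_density)
    \<comment> \<open>By \<open>off\<close> every matched term vanishes on D, so D is charged only
      by the residual product, whose whole mass is at most s.\<close>
    also have "\<dots> \<le> (\<integral>\<^sup>+z. ennreal (r (fst z) (snd z)) \<partial>(M \<Otimes>\<^sub>M N))"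
    proof (intro nn_integral_mono)
      fix z show "ennreal (f z) * indicator D z \<le> ennreal (r (fst z) (snd z))"
      proof (cases "z \<in> D")
        case True
        then have "w t / (a t * b t) * \<phi> t (fst z) * \<psi> t (snd z) = 0" if "t \<in> T" for t
          using off[of "fst z" "snd z" t] that by auto
        then have "f z = r (fst z) (snd z)"
          unfolding f_def by (simp add: sum.neutral del: mult_eq_0_iff divide_eq_0_iff)
        then show ?thesis using True by simp
      qed simp
    qed
    also have "\<dots> = (\<integral>\<^sup>+x. (\<integral>\<^sup>+y. ennreal (r x y) \<partial>N) \<partial>M)"
      by (subst N.nn_integral_fst[symmetric]) (auto simp: r_def)
    also have "\<dots> \<le> (\<integral>\<^sup>+x. ennreal (1 - u x) \<partial>M)"
    proof (intro nn_integral_mono)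
      fix x
      have "(\<integral>\<^sup>+y. ennreal (r x y) \<partial>N) = ennreal (\<integral>y. r x y \<partial>N)"
        using r0 by (intro nn_integral_eq_integral) (auto simp: r_def)
      also have "(\<integral>y. r x y \<partial>N) = (1 - u x) * (s / s)"
        using iv by (simp add: r_def)
      also have "\<dots> \<le> 1 - u x"
        using u01[of x] by (cases "s = 0") auto
      finally show "(\<integral>\<^sup>+y. ennreal (r x y) \<partial>N) \<le> ennreal (1 - u x)"
        by (simp add: ennreal_leI)
    qed
    also have "\<dots> = ennreal s"
      using iu u01 by (subst nn_integral_eq_integral) auto
    finally show ?thesis .
  qed
  ultimately show ?thesis by (auto simp: s_def w_def a_def b_def)
qed

section \<open>Marginals and push-forwards of couplings\<close>

lemma emeasure_coupling_fst:
  assumes "\<pi> \<in> couplings M N" "A \<in> sets M"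
  shows "emeasure \<pi> (fst -` A \<inter> space \<pi>) = emeasure M A"
proof -
  have [measurable_cong]: "sets \<pi> = sets (M \<Otimes>\<^sub>M N)" using assms by (simp add: couplings_def)
  have "emeasure (distr \<pi> M fst) A = emeasure \<pi> (fst -` A \<inter> space \<pi>)"
    using assms(2) by (subst emeasure_distr) auto
  then show ?thesis using assms by (simp add: couplings_def)
qed

lemma emeasure_coupling_snd:
  assumes "\<pi> \<in> couplings M N" "A \<in> sets N"
  shows "emeasure \<pi> (snd -` A \<inter> space \<pi>) = emeasure N A"
proof -
  have [measurable_cong]: "sets \<pi> = sets (M \<Otimes>\<^sub>M N)" using assms by (simp add: couplings_def)
  have "emeasure (distr \<pi> N snd) A = emeasure \<pi> (snd -` A \<inter> space \<pi>)"
    using assms(2) by (subst emeasure_distr) auto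
  then show ?thesis using assms by (simp add: couplings_def)
qed

lemma nn_integral_coupling_fst:
  assumes "\<pi> \<in> couplings M N" and [measurable]: "f \<in> borel_measurable M"
  shows "(\<integral>\<^sup>+z. f (fst z) \<partial>\<pi>) = (\<integral>\<^sup>+x. f x \<partial>M)"
proof -
  have [measurable_cong]: "sets \<pi> = sets (M \<Otimes>\<^sub>M N)" using assms by (simp add: couplings_def)
  have "(\<integral>\<^sup>+x. f x \<partial>distr \<pi> M fst) = (\<integral>\<^sup>+z. f (fst z) \<partial>\<pi>)"
    by (subst nn_integral_distr) auto
  then show ?thesis using assms by (simp add: couplings_def)
qed

lemma nn_integral_coupling_snd:
  assumes "\<pi> \<in> couplings M N" and [measurable]: "f \<in> borel_measurable N"
  shows "(\<integral>\<^sup>+z. f (snd z) \<partial>\<pi>) = (\<integral>\<^sup>+x. f x \<partial>N)"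
proof -
  have [measurable_cong]: "sets \<pi> = sets (M \<Otimes>\<^sub>M N)" using assms by (simp add: couplings_def)
  have "(\<integral>\<^sup>+x. f x \<partial>distr \<pi> N snd) = (\<integral>\<^sup>+z. f (snd z) \<partial>\<pi>)"
    by (subst nn_integral_distr) auto
  then show ?thesis using assms by (simp add: couplings_def)
qed

lemma distr_pair_in_couplings:
  assumes \<pi>: "\<pi> \<in> couplings M N"
    and f [measurable]: "f \<in> measurable M L" and g [measurable]: "g \<in> measurable N L'"
  shows "distr \<pi> (distr M L f \<Otimes>\<^sub>M distr N L' g) (\<lambda>(x, y). (f x, g y)) \<in> couplings (distr M L f) (distr N L' g)"
proof -
  have [measurable_cong]: "sets \<pi> = sets (M \<Otimes>\<^sub>M N)" and "prob_space \<pi>"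
    and m: "distr \<pi> M fst = M" "distr \<pi> N snd = N"
    using \<pi> by (auto simp: couplings_def)
  have "distr \<pi> L (\<lambda>z. f (fst z)) = distr (distr \<pi> M fst) L f"
    by (subst distr_distr) (auto simp: o_def)
  moreover have "distr \<pi> L' (\<lambda>z. g (snd z)) = distr (distr \<pi> N snd) L' g"
    by (subst distr_distr) (auto simp: o_def)
  ultimately show ?thesis
    unfolding couplings_def mem_Collect_eq using \<open>prob_space \<pi>\<close> m
    by (simp add: prob_space.prob_space_distr distr_distr o_def case_prod_beta cong: distr_cong)
qed

text \<open>A coupling on the base space pushes forward to a coupling of the laws, so it suffices to
  estimate costs on the base space. Passing back along the push-forward needs only the inequality
  \<open>nn_integral_distr_le\<close>.\<close>

lemma wasserstein_law_le:
  assumes \<pi>: "\<pi> \<in> couplings P Q" and "0 < p"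
    and [measurable]: "f \<in> measurable P (metric_borel m)" "f \<in> measurable Q (metric_borel m)"
  shows "wasserstein m p (law P m f) (law Q m f)
    \<le> enn_powr (\<integral>\<^sup>+(x, y). ennreal (mdist m (f x) (f y) powr p) \<partial>\<pi>) (1 / p)"
proof -
  have [measurable_cong]: "sets \<pi> = sets (P \<Otimes>\<^sub>M Q)"
    using \<pi> by (auto simp: couplings_def)
  let ?\<pi> = "distr \<pi> (law P m f \<Otimes>\<^sub>M law Q m f) (\<lambda>(x, y). (f x, f y))"
  have "?\<pi> \<in> couplings (law P m f) (law Q m f)"
    unfolding law_def by (intro distr_pair_in_couplings \<pi>) measurable
  then have "(INF \<pi>\<in>couplings (law P m f) (law Q m f). \<integral>\<^sup>+(x, y). ennreal (mdist m x y powr p) \<partial>\<pi>)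
    \<le> (\<integral>\<^sup>+(x, y). ennreal (mdist m x y powr p) \<partial>?\<pi>)"
    by (rule INF_lower)
  also have "\<dots> \<le> (\<integral>\<^sup>+(x, y). ennreal (mdist m (f x) (f y) powr p) \<partial>\<pi>)"
    by (rule order_trans[OF nn_integral_distr_le]) (auto simp: law_def intro!: nn_integral_mono)
  finally show ?thesis
    using \<open>0 < p\<close> unfolding wasserstein_def by (intro enn_powr_mono) auto
qed

text \<open>S is the set of good pairs, which contains all pairs from K lying in a common small
  ball. In the bound, the first P-mass of the complement of K together with \<eta> accounts for the
  unmatched mass; the other two terms account for pairs with a coordinate outside K.\<close>

lemma weakly_convergent_couplings:
  fixes P :: "'w::polish_space measure"
  assumes Pn: "\<And>n. Pn n \<in> borel_prob_measures" and P: "P \<in> borel_prob_measures"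
    and conv: "weakly_converges Pn P"
    and K: "compact K"
    and S: "S \<in> sets (borel :: ('w \<times> 'w) measure)"
    and near: "\<And>x. x \<in> K \<Longrightarrow> \<exists>r>0. \<forall>y\<in>K \<inter> ball x r. \<forall>z\<in>K \<inter> ball x r. (y, z) \<in> S"
    and "0 < \<eta>"
  shows "\<forall>\<^sub>F n in sequentially. \<exists>\<pi>\<in>couplings (Pn n) P.
    emeasure \<pi> (- S) \<le> emeasure P (- K) + ennreal \<eta> + emeasure (Pn n) (- K) + emeasure P (- K)"
proof -
  have sets_Pn [measurable_cong]: "sets (Pn n) = sets borel" for n
    using Pn by (simp add: borel_prob_measures_def)
  have sets_P [measurable_cong]: "sets P = sets borel"
    using P by (simp add: borel_prob_measures_def)
  interpret Pn: prob_space "Pn n" for n using Pn by (simp add: borel_prob_measures_def)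
  interpret P: prob_space P using P by (simp add: borel_prob_measures_def)
  have K_borel [measurable]: "K \<in> sets borel" using K by (simp add: borel_closed compact_imp_closed)
  obtain r where r: "\<And>x. x \<in> K \<Longrightarrow> 0 < r x"
    "\<And>x y z. x \<in> K \<Longrightarrow> y \<in> K \<inter> ball x (r x) \<Longrightarrow> z \<in> K \<inter> ball x (r x) \<Longrightarrow> (y, z) \<in> S"
    using near by metis
  obtain T where T: "T \<subseteq> K" "finite T" "K \<subseteq> (\<Union>x\<in>T. ball x (r x))"
    by (rule compactE_image[OF K, of K "\<lambda>x. ball x (r x)"]) (use r(1) in force)+
  define \<psi> where "\<psi> t x = max 0 (r t - dist t x)" for t x
  \<comment> \<open>Weak convergence tests functions continuous on the whole space, so the
    normalising sum must not vanish off K. The added distance to K is positive there and 0 on K, so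
    that the quotients still sum to 1 on K.\<close>
  define \<Psi> where "\<Psi> x = (\<Sum>t\<in>T. \<psi> t x) + infdist x K" for x
  define \<phi> where "\<phi> t x = \<psi> t x / \<Psi> x" for t x
  have \<psi>0: "0 \<le> \<psi> t x" for t x by (simp add: \<psi>_def)
  have \<Psi>_pos: "0 < \<Psi> x" if "T \<noteq> {}" for x
  proof (cases "x \<in> K")
    case True
    then obtain t where t: "t \<in> T" "x \<in> ball t (r t)" using T by auto
    then have "0 < (\<Sum>t\<in>T. \<psi> t x)"
      using T \<psi>0 by (intro sum_pos2[of T t]) (auto simp: \<psi>_def)
    then show ?thesis by (simp add: \<Psi>_def infdist_nonneg add_pos_nonneg)
  next
    case False
    then have "0 < infdist x K"
      using that T K by (intro infdist_pos_not_in_closed) (auto simp: compact_imp_closed)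
    then show ?thesis by (simp add: \<Psi>_def \<psi>0 sum_nonneg add_nonneg_pos)
  qed
  have \<phi>0: "0 \<le> \<phi> t x" if "t \<in> T" for t x
    using \<Psi>_pos[of x] that \<psi>0 by (auto simp: \<phi>_def intro!: divide_nonneg_pos)
  have sum_\<phi>: "(\<Sum>t\<in>T. \<phi> t x) = (\<Sum>t\<in>T. \<psi> t x) / \<Psi> x" for x
    by (simp add: \<phi>_def sum_divide_distrib)
  have \<phi>1: "(\<Sum>t\<in>T. \<phi> t x) \<le> 1" for x
    using \<Psi>_pos[of x] infdist_nonneg[of x K] unfolding sum_\<phi>
    by (cases "T = {}") (auto simp: divide_le_eq_1 \<Psi>_def)
  have \<phi>K: "(\<Sum>t\<in>T. \<phi> t x) = 1" if "x \<in> K" for x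
  proof -
    have "T \<noteq> {}" using that T by auto
    then show ?thesis using \<Psi>_pos[of x] that unfolding sum_\<phi> by (auto simp: \<Psi>_def)
  qed
  have \<phi>_ball: "x \<in> ball t (r t)" if "\<phi> t x \<noteq> 0" for t x
    using that by (auto simp: \<phi>_def \<psi>_def max_def split: if_splits)
  have \<phi>_le: "\<phi> t x \<le> 1" if "t \<in> T" for t x
    using member_le_sum[of t T "\<lambda>t. \<phi> t x"] T \<phi>0 \<phi>1[of x] that by fastforce
  have \<phi>_cont: "continuous_on UNIV (\<phi> t)" if "t \<in> T" for t
  proof -
    have "T \<noteq> {}" using that by auto
    then show ?thesis
      unfolding \<phi>_def \<psi>_def using \<Psi>_pos
      by (auto simp: \<Psi>_def[abs_def] \<psi>_def less_imp_neq[THEN not_sym]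
          intro!: continuous_intros)
  qed
  then have \<phi>_meas [measurable]: "\<phi> t \<in> borel_measurable borel" if "t \<in> T" for t
    using that borel_measurable_continuous_onI by blast
  have int\<phi>: "integrable P (\<phi> t)" if "t \<in> T" for t
    using that \<phi>0 \<phi>_le by (intro P.integrable_const_bound[where B = 1]) auto
  define s where "s Q = 1 - (\<Sum>t\<in>T. min (\<integral>x. \<phi> t x \<partial>Q) (\<integral>x. \<phi> t x \<partial>P))" for Q
  have "(\<lambda>n. \<integral>x. \<phi> t x \<partial>Pn n) \<longlonglongrightarrow> (\<integral>x. \<phi> t x \<partial>P)" if "t \<in> T" for t
  proof -
    have "bounded (range (\<phi> t))"
      using that \<phi>0 \<phi>_le by (intro boundedI[where B = 1]) auto
    then show ?thesis
      using conv \<phi>_cont[OF that] by (simp add: weakly_converges_def)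
  qed
  then have "(\<lambda>n. s (Pn n)) \<longlonglongrightarrow> 1 - (\<Sum>t\<in>T. min (\<integral>x. \<phi> t x \<partial>P) (\<integral>x. \<phi> t x \<partial>P))"
    unfolding s_def by (intro tendsto_intros) auto
  \<comment> \<open>The minima are taken at the limit, where both arguments agree. Since the
    \<open>\<phi> t\<close> sum to at least the indicator of K, the limiting unmatched mass is at
    most P(-K); \<eta> makes the inequality strict, so it holds eventually along the
    sequence.\<close>
  moreover have "1 - (\<Sum>t\<in>T. min (\<integral>x. \<phi> t x \<partial>P) (\<integral>x. \<phi> t x \<partial>P)) < measure P (- K) + \<eta>"
  proof -
    have "measure P K = (\<integral>x. indicator K x \<partial>P)"
      by (simp add: sets_eq_imp_space_eq[OF sets_P])
    also have "\<dots> \<le> (\<integral>x. (\<Sum>t\<in>T. \<phi> t x) \<partial>P)"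
      using int\<phi> \<phi>K \<phi>0
      by (intro integral_mono P.integrable_const_bound[where f = "indicator K" and B = 1])
        (auto split: split_indicator intro!: integrable_sum sum_nonneg)
    also have "\<dots> = (\<Sum>t\<in>T. \<integral>x. \<phi> t x \<partial>P)"
      using int\<phi> by (simp add: integral_sum)
    finally show ?thesis
      using P.prob_compl[of K] \<open>0 < \<eta>\<close> by (simp add: sets_eq_imp_space_eq[OF sets_P] sets_P flip: Compl_eq_Diff_UNIV)
  qed
  ultimately have "\<forall>\<^sub>F n in sequentially. s (Pn n) < measure P (- K) + \<eta>"
    by (rule order_tendstoD)
  then show ?thesis
  proof eventually_elim
    case (elim n)
    have "sets (Pn n \<Otimes>\<^sub>M P) = sets (borel \<Otimes>\<^sub>M borel)"
      by (intro sets_pair_measure_cong sets_P sets_Pn)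
    \<comment> \<open>Second countability of the Polish space enters here: closed subsets of the
      product become measurable for the product sigma-algebra.\<close>
    then have prod_borel: "sets (Pn n \<Otimes>\<^sub>M P) = sets borel"
      by (simp only: borel_prod)
    let ?D = "K \<times> K - S"
    have D: "?D \<in> sets (Pn n \<Otimes>\<^sub>M P)"
      unfolding prod_borel
      by (rule sets.Diff[OF _ S]) (intro borel_closed compact_imp_closed compact_Times K)
    \<comment> \<open>If both factors were nonzero, x and y would be points of K in the same ball
      about t, hence a pair in S.\<close>
    have off: "\<phi> t x * \<phi> t y = 0" if "(x, y) \<in> ?D" "t \<in> T" for t x y
      using that r(2)[of t x y] T(1) \<phi>_ball[of t x] \<phi>_ball[of t y] by auto
    have [measurable]: "\<phi> t \<in> borel_measurable (Pn n)" "\<phi> t \<in> borel_measurable P" if "t \<in> T" for t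
      using that by measurable
    obtain \<pi> where \<pi>: "\<pi> \<in> couplings (Pn n) P" "emeasure \<pi> ?D \<le> ennreal (s (Pn n))"
      using partition_coupling[of "Pn n" P T \<phi> \<phi> ?D, OF Pn.prob_space_axioms P.prob_space_axioms T(2)
          _ _ \<phi>0 \<phi>1 \<phi>0 \<phi>1 D off]
      by (auto simp: s_def)
    have sets_\<pi>: "sets \<pi> = sets borel" and space_\<pi>: "space \<pi> = UNIV"
      using \<pi>(1) prod_borel by (auto simp: couplings_def dest: sets_eq_imp_space_eq)
    have A: "fst -` (- K) \<in> sets \<pi>" "snd -` (- K) \<in> sets \<pi>"
    proof -
      have "open (- K)" using K by (simp add: compact_imp_closed open_Compl)
      then show "fst -` (- K) \<in> sets \<pi>" "snd -` (- K) \<in> sets \<pi>"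
        unfolding sets_\<pi> by (auto intro!: borel_open open_vimage_fst open_vimage_snd)
    qed
    have "emeasure \<pi> (- S) \<le> emeasure \<pi> (?D \<union> (fst -` (- K) \<union> snd -` (- K)))"
      using D A S by (intro emeasure_mono) (auto simp: prod_borel sets_\<pi>)
    also have "\<dots> \<le> emeasure \<pi> ?D + (emeasure \<pi> (fst -` (- K)) + emeasure \<pi> (snd -` (- K)))"
      using D A
      by (intro order_trans[OF emeasure_subadditive] add_left_mono emeasure_subadditive sets.Un)
        (auto simp: prod_borel sets_\<pi>)
    also have "emeasure \<pi> (fst -` (- K)) = emeasure (Pn n) (- K)"
      using emeasure_coupling_fst[OF \<pi>(1), of "- K"] by (simp add: space_\<pi> sets_Pn)
    also have "emeasure \<pi> (snd -` (- K)) = emeasure P (- K)"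
      using emeasure_coupling_snd[OF \<pi>(1), of "- K"] by (simp add: space_\<pi> sets_P)
    also have "emeasure \<pi> ?D \<le> emeasure P (- K) + ennreal \<eta>"
      using \<pi>(2) elim \<open>0 < \<eta>\<close>
      by (auto simp: P.emeasure_eq_measure simp flip: ennreal_plus intro: order_trans ennreal_leI)
    finally show ?case
      using \<pi>(1) by (auto simp: add.assoc)
  qed
qed

subsection \<open>Random continuous fields\<close>

text \<open>A finite bound b for g on D defines a sublevel set that is relatively closed in S; a
  closed set inducing it contains D, hence its closure, hence S.\<close>

lemma SUP_dense_subset:
  fixes g :: "'z::topological_space \<Rightarrow> real"
  assumes "D \<subseteq> S" "S \<subseteq> closure D" "continuous_on S g"
  shows "(SUP z\<in>S. ennreal (g z)) = (SUP z\<in>D. ennreal (g z))"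
proof (rule antisym)
  show "(SUP z\<in>S. ennreal (g z)) \<le> (SUP z\<in>D. ennreal (g z))" (is "_ \<le> ?B")
  proof (rule SUP_least)
    fix z assume "z \<in> S"
    show "ennreal (g z) \<le> ?B"
    proof (cases "?B = \<top>")
      case False
      then obtain b where b: "?B = ennreal b" "0 \<le> b" by (cases ?B) auto
      have "g w \<le> b" if "w \<in> D" for w
        using SUP_upper[OF that, of "\<lambda>z. ennreal (g z)"] b by (simp add: ennreal_le_iff)
      moreover obtain T where "closed T" "S \<inter> g -` {..b} = S \<inter> T"
        using continuous_closedin_preimage[OF assms(3), of "{..b}"] by (auto simp: closedin_closed)
      ultimately have "closure D \<subseteq> T"
        using assms(1) by (intro closure_minimal) auto
      then have "g z \<le> b"
        using assms(2) \<open>z \<in> S\<close> \<open>S \<inter> g -` {..b} = S \<inter> T\<close> by auto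
      then show ?thesis using b by (simp add: ennreal_leI)
    qed (simp only: top_greatest)
  qed
qed (use assms in \<open>auto intro!: SUP_subset_mono\<close>)

lemma borel_measurable_SUP_continuous:
  fixes g :: "'a \<Rightarrow> 'z::euclidean_space \<Rightarrow> real"
  assumes "\<And>x. continuous_on S (g x)" "\<And>z. z \<in> S \<Longrightarrow> (\<lambda>x. g x z) \<in> borel_measurable M"
  shows "(\<lambda>x. SUP z\<in>S. ennreal (g x z)) \<in> borel_measurable M"
proof -
  obtain D where D: "countable D" "D \<subseteq> S" "S \<subseteq> closure D" by (rule separable)
  have "(\<lambda>x. SUP z\<in>S. ennreal (g x z)) = (\<lambda>x. SUP z\<in>D. ennreal (g x z))"
    using D assms(1) by (intro ext SUP_dense_subset) auto
  then show ?thesis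
    using D assms(2) by (auto intro!: borel_measurable_SUP)
qed

text \<open>This is Heine-Cantor for a target with an abstract metric. It is reduced to the real
  function (y, z) \<mapsto> d(f y, f z) on S \<times> S by comparing (y, z) with the diagonal point
  (y, y), where that function is 0.\<close>

lemma continuous_map_compact_uniform:
  fixes f :: "'a::metric_space \<Rightarrow> 'e"
  assumes S: "compact S" and f: "continuous_map (top_of_set S) (mtopology_of m) f" and "0 < e"
  obtains d where "0 < d" "\<And>y z. y \<in> S \<Longrightarrow> z \<in> S \<Longrightarrow> dist y z < d \<Longrightarrow> mdist m (f y) (f z) < e"
proof -
  have f_in: "f y \<in> mspace m" if "y \<in> S" for y
    using continuous_map_image_subset_topspace[OF f] that by auto
  have "continuous_map (top_of_set (S \<times> S)) (top_of_set S) fst"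
    "continuous_map (top_of_set (S \<times> S)) (top_of_set S) snd"
    by (auto simp: continuous_map_in_subtopology intro!: continuous_intros)
  then have "continuous_map (top_of_set (S \<times> S)) euclidean (\<lambda>z. mdist m ((f \<circ> fst) z) ((f \<circ> snd) z))"
    by (intro continuous_map_mdist continuous_map_compose[OF _ f])
  then have "continuous_on (S \<times> S) (\<lambda>z. mdist m (f (fst z)) (f (snd z)))"
    by simp
  then have "uniformly_continuous_on (S \<times> S) (\<lambda>z. mdist m (f (fst z)) (f (snd z)))"
    using S by (intro compact_uniformly_continuous compact_Times)
  then obtain d where d: "0 < d" "\<And>y z. y \<in> S \<times> S \<Longrightarrow> z \<in> S \<times> S \<Longrightarrow> dist y z < d \<Longrightarrow>
      dist (mdist m (f (fst y)) (f (snd y))) (mdist m (f (fst z)) (f (snd z))) < e"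
    using \<open>0 < e\<close> unfolding uniformly_continuous_on_def by (metis dist_commute)
  show ?thesis
  proof
    fix y z assume yz: "y \<in> S" "z \<in> S" "dist y z < d"
    then have "dist (mdist m (f y) (f z)) (mdist m (f y) (f y)) < e"
      using d(2)[of "(y, z)" "(y, y)"] by (simp add: dist_Pair_Pair dist_commute)
    then show "mdist m (f y) (f z) < e"
      using mdist_zero[OF f_in f_in, OF yz(1) yz(1)] by (simp add: dist_real_def)
  qed fact
qed

lemma mdist_cfunspace_le_SUP:
  assumes "f \<in> mspace (cfunspace X m)" "g \<in> mspace (cfunspace X m)"
  shows "ennreal (mdist (cfunspace X m) f g) \<le> (SUP z\<in>topspace X. ennreal (mdist m (f z) (g z)))" (is "_ \<le> ?B")
proof (cases "?B = \<top>")
  case False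
  then obtain b where b: "?B = ennreal b" "0 \<le> b" by (cases ?B) auto
  have "mdist m (f z) (g z) \<le> b" if "z \<in> topspace X" for z
    using SUP_upper[OF that, of "\<lambda>z. ennreal (mdist m (f z) (g z))"] b by (simp add: ennreal_le_iff)
  then show ?thesis
    unfolding b(1) using b(2) by (intro ennreal_leI mdist_cfunspace_le) auto
qed (simp only: top_greatest)

text \<open>The fibre metric is a parameter because the jet fibre carries the sum norm rather than
  the default product metric. Measurability is asked only of the real functions giving the distance
  to a fixed point; with the countable dense set D this is enough to make the whole field
  Borel.\<close>

locale random_field =
  fixes m :: "'e metric" and C :: "'z::euclidean_space set" and G :: "'w::polish_space \<Rightarrow> 'z \<Rightarrow> 'e"
    and D :: "'e set"
  assumes mspace_UNIV [simp]: "mspace m = UNIV"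
    and compact_C: "compact C"
    and countable_D: "countable D"
    and dense_D: "\<And>e r. 0 < r \<Longrightarrow> \<exists>d\<in>D. mdist m e d < r"
    and section_continuous: "\<And>x. continuous_map (top_of_set C) (mtopology_of m) (G x)"
    and mdist_measurable: "\<And>z d. z \<in> C \<Longrightarrow> (\<lambda>x. mdist m d (G x z)) \<in> borel_measurable borel"
begin

declare mspace_cfunspace [simp del]

abbreviation "field_space \<equiv> cfunspace (top_of_set C) m"

abbreviation "field x \<equiv> restrict (G x) C"

text \<open>Compactness of C makes the boundedness condition in \<open>cfunspace\<close>
  automatic.\<close>

lemma mspace_field_space:
  "mspace field_space = {f. f \<in> extensional C \<and> continuous_map (top_of_set C) (mtopology_of m) f}"
proof -
  have "compactin (top_of_set C) (topspace (top_of_set C))"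
    using compact_C by (simp add: compactin_subtopology)
  from compactin_mspace_cfunspace[OF this, of m] show ?thesis by simp
qed

lemma field_in_space: "field x \<in> mspace field_space"
  unfolding mspace_field_space
  by (intro CollectI conjI continuous_map_eq[OF section_continuous[of x]]) simp_all

lemma const_in_space: "(\<lambda>z\<in>C. a) \<in> mspace field_space"
  unfolding mspace_field_space
proof (intro CollectI conjI)
  have "continuous_map (top_of_set C) (mtopology_of m) (\<lambda>_. a)" by simp
  then show "continuous_map (top_of_set C) (mtopology_of m) (\<lambda>z\<in>C. a)"
    by (rule continuous_map_eq) simp
qed simp

lemma field_space_mdist_leI:
  "0 \<le> b \<Longrightarrow> (\<And>z. z \<in> C \<Longrightarrow> mdist m (f z) (g z) \<le> b) \<Longrightarrow> mdist field_space f g \<le> b"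
  by (intro mdist_cfunspace_le) auto

lemma measurable_into_space:
  assumes "f \<in> space M \<rightarrow> mspace field_space"
    and "\<And>U. openin (mtopology_of field_space) U \<Longrightarrow> f -` U \<inter> space M \<in> sets M"
  shows "f \<in> measurable M (metric_borel field_space)"
  unfolding metric_borel_def borel_of_def
proof (rule measurable_measure_of)
  show "{U. openin (mtopology_of field_space) U} \<subseteq> Pow (topspace (mtopology_of field_space))"
    by (blast dest: openin_subset)
qed (use assms in simp_all)

text \<open>
  The sets of fields that stay within \<open>1 / Suc j\<close> of an element of \<open>D\<close> on each cell of a finite
  cover of \<open>C\<close> form a countable network of the field space, and membership of \<open>field x\<close> in such a
  set is decided on a countable dense subset of each cell.
\<close>

lemma field_measurable: "field \<in> measurable borel (metric_borel field_space)"
proof (rule measurable_into_space)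
  show "field \<in> space borel \<rightarrow> mspace field_space"
    using field_in_space by auto
  fix U assume U: "openin (mtopology_of field_space) U"
  have "\<exists>Z. finite Z \<and> Z \<subseteq> C \<and> C \<subseteq> (\<Union>c\<in>Z. ball c (1 / Suc k))" for k
    using seq_compact_imp_totally_bounded[of C] compact_C
    by (auto simp: compact_eq_seq_compact_metric)
  then obtain Z where Z: "\<And>k. finite (Z k)" "\<And>k. Z k \<subseteq> C" "\<And>k. C \<subseteq> (\<Union>c\<in>Z k. ball c (1 / Suc k))"
    by metis
  have "\<exists>E. countable E \<and> E \<subseteq> C \<inter> ball c (1 / Suc k) \<and> C \<inter> ball c (1 / Suc k) \<subseteq> closure E" for k c
    by (rule separable[of "C \<inter> ball c (1 / Suc k)"]) blast
  then have "\<exists>E. \<forall>k c. countable (E k c) \<and> E k c \<subseteq> C \<inter> ball c (1 / Suc k) \<and> C \<inter> ball c (1 / Suc k) \<subseteq> closure (E k c)"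
    by (intro choice allI)
  then obtain E where "\<forall>k c. countable (E k c) \<and> E k c \<subseteq> C \<inter> ball c (1 / Suc k) \<and> C \<inter> ball c (1 / Suc k) \<subseteq> closure (E k c)"
    by (elim exE)
  then have E: "countable (E k c)" "E k c \<subseteq> C \<inter> ball c (1 / Suc k)" "C \<inter> ball c (1 / Suc k) \<subseteq> closure (E k c)" for k c
    by simp_all
  \<comment> \<open>In a code, k is the mesh of the cover, j the tolerance, and \<sigma> assigns a
    point of D to each cell. There are countably many codes because every cover \<open>Z k\<close>
    is finite.\<close>
  define codes where "codes = (SIGMA k:UNIV. (UNIV :: nat set) \<times> (\<Pi>\<^sub>E c\<in>Z k. D))"
  define A where "A = (\<lambda>(k, j, \<sigma>). {f \<in> mspace field_space.
    \<forall>c\<in>Z k. \<forall>z\<in>C \<inter> ball c (1 / Suc k). mdist m (\<sigma> c) (f z) \<le> 1 / Suc j})"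
  define A' where "A' = (\<lambda>(k, j, \<sigma>). {x. \<forall>c\<in>Z k. \<forall>z\<in>E k c. mdist m (\<sigma> c) (G x z) \<le> 1 / Suc j})"
  have countable: "countable codes"
    unfolding codes_def using countable_D Z(1) by (intro countable_SIGMA countable_PiE) auto
  have A'_borel: "A' \<kappa> \<in> sets borel" for \<kappa>
  proof -
    obtain k j \<sigma> where \<kappa>: "\<kappa> = (k, j, \<sigma>)" by (cases \<kappa>)
    have "{x. mdist m (\<sigma> c) (G x z) \<le> 1 / Suc j} \<in> sets borel" if "z \<in> E k c" for c z
      using mdist_measurable[of z "\<sigma> c"] E(2)[of k c] that
      by (auto intro!: borel_measurable_le[where M = borel, simplified])
    then have "(\<Inter>c\<in>Z k. \<Inter>z\<in>E k c. {x. mdist m (\<sigma> c) (G x z) \<le> 1 / Suc j}) \<in> sets borel"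
      using Z(1)[of k] E(1)[of k]
      by (intro sets.countable_INT'' ) (auto intro: countable_finite)
    also have "(\<Inter>c\<in>Z k. \<Inter>z\<in>E k c. {x. mdist m (\<sigma> c) (G x z) \<le> 1 / Suc j}) = A' \<kappa>"
      by (auto simp: A'_def \<kappa>)
    finally show ?thesis .
  qed
  have A'_iff: "x \<in> A' \<kappa> \<longleftrightarrow> field x \<in> A \<kappa>" for x \<kappa>
  proof -
    obtain k j \<sigma> where \<kappa>: "\<kappa> = (k, j, \<sigma>)" by (cases \<kappa>)
    have "mdist m (\<sigma> c) (G x z) \<le> 1 / Suc j"
      if "\<forall>z\<in>E k c. mdist m (\<sigma> c) (G x z) \<le> 1 / Suc j" "z \<in> C \<inter> ball c (1 / Suc k)" for c z
    proof -
      have "continuous_on C (\<lambda>z. mdist m (\<sigma> c) (G x z))"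
        using continuous_map_mdist[OF _ section_continuous[of x], of "\<lambda>_. \<sigma> c"] by simp
      then have "continuous_on (C \<inter> ball c (1 / Suc k)) (\<lambda>z. mdist m (\<sigma> c) (G x z))"
        by (rule continuous_on_subset) auto
      from SUP_dense_subset[OF E(2,3) this]
      have "(SUP z\<in>C \<inter> ball c (1 / Suc k). ennreal (mdist m (\<sigma> c) (G x z))) \<le> ennreal (1 / Suc j)"
        using that(1) by (auto intro!: SUP_least ennreal_leI)
      then show ?thesis
        using that(2) by (subst (asm) SUP_le_iff) (auto simp del: of_nat_Suc)
    qed
    then show ?thesis
      using E(2)[of k] field_in_space[of x] by (fastforce simp: A_def A'_def \<kappa>)
  qed
  have "\<exists>\<kappa>\<in>codes. A \<kappa> \<subseteq> U \<and> field x \<in> A \<kappa>" if "field x \<in> U" for x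
  proof -
    have "\<exists>r>0. \<forall>g\<in>mspace field_space. mdist field_space (field x) g < r \<longrightarrow> g \<in> U"
      using U that unfolding mtopology_of_def
      by (subst (asm) Metric_space.openin_mtopology) (fastforce simp: Metric_space.in_mball)+
    then obtain r where r: "0 < r"
      "\<And>g. g \<in> mspace field_space \<Longrightarrow> mdist field_space (field x) g < r \<Longrightarrow> g \<in> U" by blast
    \<comment> \<open>Two members of the same set \<open>A\<close> agree up to twice the tolerance
      1/(j+1), which is now below r. Half the tolerance, \<open>e\<close>, is reserved for the
      oscillation of the field on a cell and half for approximating its value at the centre by
      D.\<close>
    obtain j where j: "1 / Suc j < r / 2"
      using reals_Archimedean[of "r / 2"] r by (auto simp: inverse_eq_divide)
    define e where "e = 1 / (2 * real (Suc j))"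
    have e: "0 < e" "e + e = 1 / Suc j" by (auto simp: e_def field_simps)
    obtain d where d: "0 < d" "\<And>y z. y \<in> C \<Longrightarrow> z \<in> C \<Longrightarrow> dist y z < d \<Longrightarrow> mdist m (G x y) (G x z) < e"
      using continuous_map_compact_uniform[OF compact_C section_continuous e(1)] by metis
    obtain k where k: "1 / Suc k < d"
      using reals_Archimedean[of d] d by (auto simp: inverse_eq_divide)
    have "\<forall>c. \<exists>d. d \<in> D \<and> mdist m (G x c) d < e"
      using dense_D[OF e(1)] by blast
    then obtain \<sigma>0 where "\<forall>c. \<sigma>0 c \<in> D \<and> mdist m (G x c) (\<sigma>0 c) < e"
      by (rule choice[elim_format]) (elim exE)
    then have \<sigma>0: "\<sigma>0 c \<in> D" "mdist m (G x c) (\<sigma>0 c) < e" for c by simp_all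
    define \<sigma> where "\<sigma> = restrict \<sigma>0 (Z k)"
    have "(k, j, \<sigma>) \<in> codes" using \<sigma>0 by (auto simp: codes_def \<sigma>_def)
    moreover have "mdist m (\<sigma> c) (field x z) \<le> 1 / Suc j" if c: "c \<in> Z k" "z \<in> C" "dist c z < 1 / Suc k" for c z
    proof -
      have "dist c z < d" using c k by linarith
      then have "mdist m (G x c) (G x z) < e" using d(2)[of c z] c Z(2) by auto
      then have "mdist m (\<sigma>0 c) (G x z) \<le> e + e"
        using mdist_triangle[of "\<sigma>0 c" m "G x c" "G x z"] \<sigma>0(2)[of c] by (simp add: mdist_commute)
      then show ?thesis
        using e c by (simp add: \<sigma>_def)
    qed
    then have "field x \<in> A (k, j, \<sigma>)"
      using field_in_space[of x] by (simp add: A_def)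
    moreover have "A (k, j, \<sigma>) \<subseteq> U"
    proof
      fix g assume g: "g \<in> A (k, j, \<sigma>)"
      have "mdist field_space (field x) g \<le> 1 / Suc j + 1 / Suc j"
      proof (intro field_space_mdist_leI)
        fix z assume z: "z \<in> C"
        then obtain c where "c \<in> Z k" "z \<in> ball c (1 / Suc k)" using Z(3)[of k] by auto
        then have "mdist m (\<sigma> c) (field x z) \<le> 1 / Suc j" "mdist m (\<sigma> c) (g z) \<le> 1 / Suc j"
          using z g \<open>field x \<in> A (k, j, \<sigma>)\<close> unfolding A_def by auto
        then show "mdist m (field x z) (g z) \<le> 1 / Suc j + 1 / Suc j"
          using mdist_triangle[of "field x z" m "\<sigma> c" "g z"] by (simp add: mdist_commute)
      qed simp
      then show "g \<in> U" using r(2)[of g] g j by (auto simp: A_def)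
    qed
    ultimately show ?thesis using \<open>field x \<in> A (k, j, \<sigma>)\<close> by blast
  qed
  \<comment> \<open>U contains every network set that was chosen around one of its fields, so its
    preimage is a countable union of the Borel sets \<open>A'\<close>.\<close>
  then have "field -` U = {x. \<exists>\<kappa>\<in>codes. A \<kappa> \<subseteq> U \<and> field x \<in> A \<kappa>}"
    by blast
  also have "\<dots> = (\<Union>\<kappa>\<in>{\<kappa>\<in>codes. A \<kappa> \<subseteq> U}. A' \<kappa>)"
    unfolding A'_iff[symmetric] by blast
  also have "\<dots> \<in> sets borel"
    using countable A'_borel by (intro sets.countable_UN') auto
  finally show "field -` U \<inter> space borel \<in> sets borel" by simp
qed

text \<open>Joint continuity on the compact set K \<times> C is uniform, so a small move of x
  displaces all sections at once. The bound e/2 is used because passing to the supremum over z loses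
  strictness.\<close>

lemma field_continuous_map:
  assumes "compact K" and G: "continuous_map (top_of_set (K \<times> C)) (mtopology_of m) (\<lambda>(x, z). G x z)"
  shows "continuous_map (top_of_set K) (mtopology_of field_space) field"
  unfolding mtopology_of_def
proof (subst Metric_space.continuous_map_to_metric[OF Metric_space_mspace_mdist], intro ballI allI impI)
  fix x and e :: real assume x: "x \<in> topspace (top_of_set K)" and "0 < e"
  obtain d where d: "0 < d" "\<And>y z. y \<in> K \<times> C \<Longrightarrow> z \<in> K \<times> C \<Longrightarrow> dist y z < d \<Longrightarrow>
      mdist m (case y of (x, z) \<Rightarrow> G x z) (case z of (x, z) \<Rightarrow> G x z) < e / 2"
    using continuous_map_compact_uniform[OF compact_Times[OF \<open>compact K\<close> compact_C] G, of "e / 2"] \<open>0 < e\<close>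
    by auto
  have "mdist field_space (field x) (field y) < e" if "y \<in> K" "dist x y < d" for y
  proof -
    have "mdist field_space (field x) (field y) \<le> e / 2"
    proof (rule field_space_mdist_leI)
      fix z assume "z \<in> C"
      then show "mdist m (field x z) (field y z) \<le> e / 2"
        using d(2)[of "(x, z)" "(y, z)"] that x by (simp add: dist_Pair_Pair)
    qed (use \<open>0 < e\<close> in simp)
    then show ?thesis using \<open>0 < e\<close> by simp
  qed
  moreover have "openin (top_of_set K) (K \<inter> ball x d)" by auto
  ultimately show "\<exists>U. openin (top_of_set K) U \<and> x \<in> U \<and>
      (\<forall>y\<in>U. field y \<in> Metric_space.mball (mspace field_space) (mdist field_space) (field x) e)"
    using x d(1) field_in_space
    by (intro exI[of _ "K \<inter> ball x d"]) (auto simp: Metric_space.in_mball)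
qed

text \<open>A majorant of the distance from the field to the constant field a, in a form whose
  measurability in x is visible. With base point 0 it is the supremum over C of the fibre
  norm.\<close>

definition "envelope a x = (SUP z\<in>C. ennreal (mdist m a (G x z)))"

lemma envelope_measurable [measurable]: "envelope a \<in> borel_measurable borel"
  unfolding envelope_def[abs_def]
proof (rule borel_measurable_SUP_continuous)
  show "continuous_on C (\<lambda>z. mdist m a (G x z))" for x
    using continuous_map_mdist[OF _ section_continuous[of x], of "\<lambda>_. a"] by simp
qed (rule mdist_measurable)

lemma mdist_le_envelope: "ennreal (mdist field_space (\<lambda>z\<in>C. a) (field x)) \<le> envelope a x"
proof -
  have "(SUP z\<in>C. ennreal (mdist m ((\<lambda>z\<in>C. a) z) (field x z))) = envelope a x"
    unfolding envelope_def by (intro SUP_cong) simp_all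
  then show ?thesis
    using mdist_cfunspace_le_SUP[OF const_in_space[of a] field_in_space[of x]] by simp
qed

lemma mdist_field_le_envelopes:
  "ennreal (mdist field_space (field x) (field y)) \<le> envelope a x + envelope a y"
proof -
  have "ennreal (mdist field_space (field x) (field y))
      \<le> ennreal (mdist field_space (\<lambda>z\<in>C. a) (field x) + mdist field_space (\<lambda>z\<in>C. a) (field y))"
    using mdist_triangle[OF field_in_space[of x] const_in_space[of a] field_in_space[of y]]
    by (intro ennreal_leI) (simp add: mdist_commute)
  also have "\<dots> \<le> envelope a x + envelope a y"
    using mdist_le_envelope[of a x] mdist_le_envelope[of a y] by (simp add: add_mono)
  finally show ?thesis .
qed

text \<open>The constant field serves as base point, and Hoelder is applied on the whole space,
  whose mass is 1.\<close>

lemma finite_moment_law: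
  assumes P: "P \<in> borel_prob_measures" and pq: "0 < p" "p < q"
    and moment: "(\<integral>\<^sup>+x. enn_powr (envelope a x) q \<partial>P) < \<infinity>"
  shows "finite_moment field_space p (law P field_space field)"
  unfolding finite_moment_def
proof (intro bexI)
  interpret prob_space P using P by (simp add: borel_prob_measures_def)
  have [measurable_cong]: "sets P = sets borel" using P by (simp add: borel_prob_measures_def)
  have [measurable]: "field \<in> measurable P (metric_borel field_space)"
    using field_measurable by (simp cong: measurable_cong_sets)
  have "(\<integral>\<^sup>+f. ennreal (mdist field_space (\<lambda>z\<in>C. a) f powr p) \<partial>law P field_space field)
      \<le> (\<integral>\<^sup>+x. ennreal (mdist field_space (\<lambda>z\<in>C. a) (field x) powr p) \<partial>P)"
    unfolding law_def by (intro nn_integral_distr_le) measurable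
  also have "\<dots> \<le> (\<integral>\<^sup>+x. enn_powr (envelope a x) p * indicator (space P) x \<partial>P)"
    using pq by (intro nn_integral_mono) (simp add: ennreal_powr_le_enn_powr mdist_le_envelope)
  also have "\<dots> \<le> enn_powr (\<integral>\<^sup>+x. enn_powr (envelope a x) q \<partial>P) (p / q) * enn_powr (emeasure P (space P)) (1 - p / q)"
    using pq by (intro nn_integral_enn_powr_set_le) (auto simp: emeasure_space_1)
  also have "\<dots> < \<infinity>"
    using moment enn_powr_ennreal[of 1] by (simp add: emeasure_space_1)
  finally show "(\<integral>\<^sup>+f. ennreal (mdist field_space (\<lambda>z\<in>C. a) f powr p) \<partial>law P field_space field) < \<infinity>" .
qed (rule const_in_space)

text \<open>The transport cost is split along S. On S it is at most \<epsilon>^p. Off S the triangle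
  inequality through a constant field bounds the distance by the sum of two envelopes, and Hoelder
  trades their q-th moment for a power of the mass of the complement of S.\<close>

lemma wasserstein_law_coupling_le:
  assumes P: "P \<in> borel_prob_measures" and Q: "Q \<in> borel_prob_measures" and pq: "0 < p" "p < q"
    and \<pi>: "\<pi> \<in> couplings P Q" and S [measurable]: "S \<in> sets borel" and "0 \<le> \<epsilon>"
    and near: "\<And>x y. (x, y) \<in> S \<Longrightarrow> mdist field_space (field x) (field y) \<le> \<epsilon>"
    and moments: "(\<integral>\<^sup>+x. enn_powr (envelope a x) q \<partial>P) \<le> B" "(\<integral>\<^sup>+x. enn_powr (envelope a x) q \<partial>Q) \<le> B"
  shows "wasserstein field_space p (law P field_space field) (law Q field_space field)
    \<le> enn_powr (enn_powr (ennreal \<epsilon>) p +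
        enn_powr (enn_powr 2 q * (B + B)) (p / q) * enn_powr (emeasure \<pi> (- S)) (1 - p / q)) (1 / p)"
proof -
  have sets_P [measurable_cong]: "sets P = sets borel" and sets_Q [measurable_cong]: "sets Q = sets borel"
    using P Q by (auto simp: borel_prob_measures_def)
  have "sets \<pi> = sets (borel \<Otimes>\<^sub>M borel)"
    using \<pi> sets_pair_measure_cong[OF sets_P sets_Q] by (simp add: couplings_def)
  then have sets_\<pi>: "sets \<pi> = sets borel" by (simp only: borel_prod)
  have sets_\<pi>' [measurable_cong]: "sets \<pi> = sets (borel \<Otimes>\<^sub>M borel)" by fact
  have space_\<pi>: "space \<pi> = UNIV" using sets_eq_imp_space_eq[OF sets_\<pi>] by simp
  have [measurable]: "- S \<in> sets \<pi>"
    unfolding sets_\<pi> using sets.compl_sets[OF S] by (simp add: Compl_eq_Diff_UNIV)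
  interpret \<pi>: prob_space \<pi> using \<pi> by (simp add: couplings_def)
  define E where "E z = envelope a (fst z) + envelope a (snd z)" for z
  have [measurable]: "E \<in> borel_measurable \<pi>"
    unfolding E_def by measurable
  \<comment> \<open>Each summand depends on one coordinate only, so the moment is controlled by the
    marginals alone, whatever the coupling.\<close>
  have "(\<integral>\<^sup>+z. enn_powr (E z) q \<partial>\<pi>)
      \<le> (\<integral>\<^sup>+z. enn_powr 2 q * (enn_powr (envelope a (fst z)) q + enn_powr (envelope a (snd z)) q) \<partial>\<pi>)"
    unfolding E_def using pq by (intro nn_integral_mono enn_powr_add_le) auto
  also have "\<dots> = enn_powr 2 q * ((\<integral>\<^sup>+z. enn_powr (envelope a (fst z)) q \<partial>\<pi>) + (\<integral>\<^sup>+z. enn_powr (envelope a (snd z)) q \<partial>\<pi>))"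
    by (simp add: nn_integral_cmult nn_integral_add)
  also have "(\<integral>\<^sup>+z. enn_powr (envelope a (fst z)) q \<partial>\<pi>) = (\<integral>\<^sup>+x. enn_powr (envelope a x) q \<partial>P)"
    by (rule nn_integral_coupling_fst[OF \<pi>]) measurable
  also have "(\<integral>\<^sup>+z. enn_powr (envelope a (snd z)) q \<partial>\<pi>) = (\<integral>\<^sup>+x. enn_powr (envelope a x) q \<partial>Q)"
    by (rule nn_integral_coupling_snd[OF \<pi>]) measurable
  also have "enn_powr 2 q * ((\<integral>\<^sup>+x. enn_powr (envelope a x) q \<partial>P) + (\<integral>\<^sup>+x. enn_powr (envelope a x) q \<partial>Q))
      \<le> enn_powr 2 q * (B + B)"
    by (intro mult_left_mono add_mono moments) simp
  finally have E_moment: "(\<integral>\<^sup>+z. enn_powr (E z) q \<partial>\<pi>) \<le> enn_powr 2 q * (B + B)" .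
  have "(\<integral>\<^sup>+(x, y). ennreal (mdist field_space (field x) (field y) powr p) \<partial>\<pi>)
      \<le> (\<integral>\<^sup>+z. enn_powr (ennreal \<epsilon>) p + enn_powr (E z) p * indicator (- S) z \<partial>\<pi>)"
  proof (rule nn_integral_mono, clarify)
    fix x y
    show "ennreal (mdist field_space (field x) (field y) powr p)
        \<le> enn_powr (ennreal \<epsilon>) p + enn_powr (E (x, y)) p * indicator (- S) (x, y)"
    proof (cases "(x, y) \<in> S")
      case True
      then have "ennreal (mdist field_space (field x) (field y) powr p) \<le> enn_powr (ennreal \<epsilon>) p"
        using pq near[of x y] by (intro ennreal_powr_le_enn_powr ennreal_leI) auto
      then show ?thesis using True by simp
    next
      case False
      have "ennreal (mdist field_space (field x) (field y) powr p) \<le> enn_powr (E (x, y)) p"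
        using pq mdist_field_le_envelopes[of x y a] by (intro ennreal_powr_le_enn_powr) (auto simp: E_def)
      then show ?thesis using False by (simp add: add_increasing)
    qed
  qed
  also have "\<dots> = enn_powr (ennreal \<epsilon>) p + (\<integral>\<^sup>+z. enn_powr (E z) p * indicator (- S) z \<partial>\<pi>)"
    by (simp add: nn_integral_add \<pi>.emeasure_space_1)
  also have "(\<integral>\<^sup>+z. enn_powr (E z) p * indicator (- S) z \<partial>\<pi>)
      \<le> enn_powr (\<integral>\<^sup>+z. enn_powr (E z) q \<partial>\<pi>) (p / q) * enn_powr (emeasure \<pi> (- S)) (1 - p / q)"
    using pq by (intro nn_integral_enn_powr_set_le) (auto simp: less_top[symmetric])
  also have "\<dots> \<le> enn_powr (enn_powr 2 q * (B + B)) (p / q) * enn_powr (emeasure \<pi> (- S)) (1 - p / q)"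
    using pq by (intro mult_right_mono enn_powr_mono E_moment) auto
  finally have cost: "(\<integral>\<^sup>+(x, y). ennreal (mdist field_space (field x) (field y) powr p) \<partial>\<pi>)
      \<le> enn_powr (ennreal \<epsilon>) p + enn_powr (enn_powr 2 q * (B + B)) (p / q) * enn_powr (emeasure \<pi> (- S)) (1 - p / q)"
    by (simp add: add_left_mono)
  have "field \<in> measurable P (metric_borel field_space)" "field \<in> measurable Q (metric_borel field_space)"
    using field_measurable by (simp_all cong: measurable_cong_sets)
  from wasserstein_law_le[OF \<pi> \<open>0 < p\<close> this] show ?thesis
    using pq by (elim order_trans) (intro enn_powr_mono cost, simp)
qed

text \<open>Restricting to K \<times> K, where the field is continuous, makes the set of near pairs
  closed and hence Borel; on the whole space this would require measurability of the distance
  between fields. The local condition is uniform continuity on K, with radius d/2 so that two points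
  of a ball are within d.\<close>

lemma field_near_set:
  assumes "compact K" and G: "continuous_map (top_of_set (K \<times> C)) (mtopology_of m) (\<lambda>(x, z). G x z)"
    and "0 < \<epsilon>"
  defines "S \<equiv> {(x, y) \<in> K \<times> K. mdist field_space (field x) (field y) \<le> \<epsilon>}"
  shows "S \<in> sets borel"
    and "\<And>x. x \<in> K \<Longrightarrow> \<exists>r>0. \<forall>y\<in>K \<inter> ball x r. \<forall>z\<in>K \<inter> ball x r. (y, z) \<in> S"
proof -
  note f = field_continuous_map[OF assms(1) G]
  have "continuous_map (top_of_set (K \<times> K)) (top_of_set K) fst"
    "continuous_map (top_of_set (K \<times> K)) (top_of_set K) snd"
    by (auto simp: continuous_map_in_subtopology intro!: continuous_intros)
  then have "continuous_map (top_of_set (K \<times> K)) euclidean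
      (\<lambda>z. mdist field_space ((field \<circ> fst) z) ((field \<circ> snd) z))"
    by (intro continuous_map_mdist continuous_map_compose[OF _ f])
  then have "continuous_on (K \<times> K) (\<lambda>z. mdist field_space (field (fst z)) (field (snd z)))"
    by simp
  moreover have "closed (K \<times> K)" using \<open>compact K\<close> by (intro closed_Times compact_imp_closed)
  ultimately have "closed {z \<in> K \<times> K. mdist field_space (field (fst z)) (field (snd z)) \<le> \<epsilon>}"
    by (intro continuous_on_closed_Collect_le continuous_on_const)
  also have "{z \<in> K \<times> K. mdist field_space (field (fst z)) (field (snd z)) \<le> \<epsilon>} = S"
    by (auto simp: S_def)
  finally show "S \<in> sets borel" by (rule borel_closed)
  obtain d where d: "0 < d"
    "\<And>y z. y \<in> K \<Longrightarrow> z \<in> K \<Longrightarrow> dist y z < d \<Longrightarrow> mdist field_space (field y) (field z) < \<epsilon>"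
    using continuous_map_compact_uniform[OF assms(1) f \<open>0 < \<epsilon>\<close>] by blast
  fix x assume "x \<in> K"
  have "(y, z) \<in> S" if "y \<in> K \<inter> ball x (d / 2)" "z \<in> K \<inter> ball x (d / 2)" for y z
  proof -
    have "dist y z < d"
      using that dist_triangle_half_r[of x y d z] by auto
    then show ?thesis using d(2)[of y z] that by (auto simp: S_def)
  qed
  then show "\<exists>r>0. \<forall>y\<in>K \<inter> ball x r. \<forall>z\<in>K \<inter> ball x r. (y, z) \<in> S"
    using d(1) by (intro exI[of _ "d / 2"]) auto
qed

text \<open>For fixed k, weak convergence gives the bound \<open>b k\<close> for all large n; only
  afterwards does k grow. The constant c is uniform over \<P>, so the moment bound survives both
  limits.\<close>

lemma wasserstein_law_tendsto:
  assumes \<P>: "\<P> \<subseteq> borel_prob_measures" and core: "compact_capacity_core \<P> K"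
    and G: "\<And>R. 1 \<le> R \<Longrightarrow> continuous_map (top_of_set (K R \<times> C)) (mtopology_of m) (\<lambda>(x, z). G x z)"
    and pq: "0 < p" "p < q"
    and moment: "(SUP P\<in>\<P>. \<integral>\<^sup>+x. enn_powr (envelope a x) q \<partial>P) < \<infinity>"
    and Pn: "\<And>n. Pn n \<in> \<P>" and P: "P \<in> \<P>" and conv: "weakly_converges Pn P"
  shows "(\<lambda>n. wasserstein field_space p (law (Pn n) field_space field) (law P field_space field))
    \<longlonglongrightarrow> 0"
proof -
  define B where "B = (SUP P\<in>\<P>. \<integral>\<^sup>+x. enn_powr (envelope a x) q \<partial>P)"
  define c where "c = enn_powr (enn_powr 2 q * (B + B)) (p / q)"
  have c: "c < \<top>"
    using moment enn_powr_ennreal[of 2 q] by (simp add: c_def B_def ennreal_mult_less_top)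
  define \<epsilon> where "\<epsilon> k = 1 / real (Suc k)" for k
  \<comment> \<open>One index controls both the tolerance and the core. \<open>Suc k\<close> is used
    because the core is constrained only from index 1 on. The three defects bound the three
    complement masses in \<open>weakly_convergent_couplings\<close>.\<close>
  define \<theta> where "\<theta> k = core_defect \<P> K (Suc k) + ennreal (\<epsilon> k) + core_defect \<P> K (Suc k) + core_defect \<P> K (Suc k)" for k
  define b where "b k = enn_powr (enn_powr (ennreal (\<epsilon> k)) p + c * enn_powr (\<theta> k) (1 - p / q)) (1 / p)" for k
  have \<epsilon>0: "(\<lambda>k. ennreal (\<epsilon> k)) \<longlonglongrightarrow> 0"
    unfolding \<epsilon>_def using tendsto_ennrealI[OF LIMSEQ_Suc[OF lim_1_over_n]] by simp
  have \<tau>0: "(\<lambda>k. core_defect \<P> K (Suc k)) \<longlonglongrightarrow> 0"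
    using core by (simp add: compact_capacity_core_def LIMSEQ_Suc)
  have "\<theta> \<longlonglongrightarrow> 0"
    unfolding \<theta>_def using tendsto_add[OF tendsto_add[OF tendsto_add[OF \<tau>0 \<epsilon>0] \<tau>0] \<tau>0] by simp
  then have "(\<lambda>k. c * enn_powr (\<theta> k) (1 - p / q)) \<longlonglongrightarrow> 0"
    using pq ennreal_tendsto_cmult[OF c tendsto_enn_powr_0[of \<theta> sequentially "1 - p / q"]] by simp
  then have b0: "b \<longlonglongrightarrow> 0"
    unfolding b_def using pq tendsto_add[OF tendsto_enn_powr_0[OF \<epsilon>0 pq(1)]]
    by (intro tendsto_enn_powr_0) auto
  have "\<forall>\<^sub>F n in sequentially. wasserstein field_space p (law (Pn n) field_space field) (law P field_space field) \<le> b k" for k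
  proof -
    have K: "compact (K (Suc k))" using core by (simp add: compact_capacity_core_def)
    define S where "S = {(x, y) \<in> K (Suc k) \<times> K (Suc k). mdist field_space (field x) (field y) \<le> \<epsilon> k}"
    have "0 < \<epsilon> k" by (simp add: \<epsilon>_def)
    note S = field_near_set[OF K G this, folded S_def, simplified]
    have "\<forall>\<^sub>F n in sequentially. \<exists>\<pi>\<in>couplings (Pn n) P. emeasure \<pi> (- S)
        \<le> emeasure P (- K (Suc k)) + ennreal (\<epsilon> k) + emeasure (Pn n) (- K (Suc k)) + emeasure P (- K (Suc k))"
      using Pn P \<P> by (intro weakly_convergent_couplings conv K S \<open>0 < \<epsilon> k\<close>) auto
    then show ?thesis
    proof eventually_elim
      case (elim n)
      then obtain \<pi> where \<pi>: "\<pi> \<in> couplings (Pn n) P" "emeasure \<pi> (- S)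
        \<le> emeasure P (- K (Suc k)) + ennreal (\<epsilon> k) + emeasure (Pn n) (- K (Suc k)) + emeasure P (- K (Suc k))"
        by blast
      have "emeasure Q (- K (Suc k)) \<le> core_defect \<P> K (Suc k)" if "Q \<in> \<P>" for Q
        unfolding core_defect_def using that by (rule SUP_upper)
      then have \<theta>: "emeasure \<pi> (- S) \<le> \<theta> k"
        unfolding \<theta>_def using Pn P by (intro order_trans[OF \<pi>(2)] add_mono) auto
      have moments: "(\<integral>\<^sup>+x. enn_powr (envelope a x) q \<partial>Q) \<le> B" if "Q \<in> \<P>" for Q
        unfolding B_def using that by (rule SUP_upper)
      have "wasserstein field_space p (law (Pn n) field_space field) (law P field_space field)
        \<le> enn_powr (enn_powr (ennreal (\<epsilon> k)) p + c * enn_powr (emeasure \<pi> (- S)) (1 - p / q)) (1 / p)"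
        unfolding c_def
        using Pn P \<P> \<open>0 < \<epsilon> k\<close>
        by (intro wasserstein_law_coupling_le[OF _ _ pq \<pi>(1) S(1), where a = a] moments) (auto simp: S_def)
      also have "\<dots> \<le> b k"
        unfolding b_def using pq by (intro enn_powr_mono add_left_mono mult_left_mono \<theta>) auto
      finally show ?case .
    qed
  qed
  note bound = this
  show ?thesis
  proof (rule order_tendstoI)
    fix e :: ennreal assume "0 < e"
    then obtain k where "b k < e"
      using order_tendstoD(2)[OF b0] by (auto simp: eventually_sequentially)
    then show "\<forall>\<^sub>F n in sequentially.
        wasserstein field_space p (law (Pn n) field_space field) (law P field_space field) < e"
      using bound[of k] by (auto elim: eventually_mono)
  qed simp
qed

end

subsection \<open>The first-order remainder and the field spaces\<close>

lemma countable_dense_points: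
  obtains D :: "'a::{metric_space, second_countable_topology} set"
  where "countable D" "\<And>x r. 0 < r \<Longrightarrow> \<exists>d\<in>D. dist x d < r"
proof -
  obtain D :: "'a set" where D: "countable D" "\<And>X. open X \<Longrightarrow> X \<noteq> {} \<Longrightarrow> \<exists>d\<in>D. d \<in> X"
    by (rule countable_dense_setE) blast
  have "\<exists>d\<in>D. dist x d < r" if "0 < r" for x r
    using D(2)[of "ball x r"] that by auto
  then show thesis using that D(1) by blast
qed

text \<open>Finite dimension of the domain is what makes the operator space separable: an operator
  is determined by its values on a basis, and these are approximated from a countable dense
  set.\<close>

lemma countable_dense_blinfuns:
  obtains D :: "('z::euclidean_space \<Rightarrow>\<^sub>L 'b::{real_normed_vector, second_countable_topology}) set"
  where "countable D" "\<And>f r. 0 < r \<Longrightarrow> \<exists>d\<in>D. dist f d < r"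
proof -
  obtain D0 :: "'b set" where D0: "countable D0" "\<And>x r. 0 < r \<Longrightarrow> \<exists>d\<in>D0. dist x d < r"
    by (rule countable_dense_points) blast
  define L where "L \<sigma> = Blinfun (\<lambda>x::'z. \<Sum>i\<in>Basis. (x \<bullet> i) *\<^sub>R \<sigma> i)" for \<sigma> :: "'z \<Rightarrow> 'b"
  have L: "blinfun_apply (L \<sigma>) x = (\<Sum>i\<in>Basis. (x \<bullet> i) *\<^sub>R \<sigma> i)" for \<sigma> x
    unfolding L_def
    by (subst bounded_linear_Blinfun_apply)
      (auto intro!: bounded_linear_sum bounded_linear_scaleR_const bounded_linear_inner_left)
  have "\<exists>d\<in>L ` (Basis \<rightarrow>\<^sub>E D0). dist f d < r" if "0 < r" for f r
  proof -
    \<comment> \<open>An error e at each basis vector costs at most DIM * e in operator norm,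
      because coordinates are bounded by the norm; the extra factor 2 makes the result strictly less
      than r.\<close>
    define e where "e = r / (2 * DIM('z))"
    have e: "0 < e" "DIM('z) * e < r" using that by (auto simp: e_def)
    have "\<forall>i. \<exists>d. d \<in> D0 \<and> dist (blinfun_apply f i) d < e"
      using D0(2)[OF e(1)] by blast
    then obtain \<sigma> where "\<forall>i. \<sigma> i \<in> D0 \<and> dist (blinfun_apply f i) (\<sigma> i) < e"
      by (rule choice[elim_format]) (elim exE)
    then have \<sigma>: "\<sigma> i \<in> D0" "norm (blinfun_apply f i - \<sigma> i) < e" for i
      by (simp_all add: dist_norm)
    have "norm (f - L (restrict \<sigma> Basis)) \<le> DIM('z) * e"
    proof (rule norm_blinfun_bound)
      fix x
      have "blinfun_apply f x = (\<Sum>i\<in>Basis. (x \<bullet> i) *\<^sub>R blinfun_apply f i)"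
        by (subst euclidean_representation[of x, symmetric])
          (simp add: blinfun.sum_right blinfun.scaleR_right del: euclidean_representation)
      then have "blinfun_apply (f - L (restrict \<sigma> Basis)) x = (\<Sum>i\<in>Basis. (x \<bullet> i) *\<^sub>R (blinfun_apply f i - \<sigma> i))"
        by (simp add: blinfun.diff_left L scaleR_right_diff_distrib sum_subtractf)
      also have "norm \<dots> \<le> (\<Sum>i\<in>(Basis::'z set). norm x * e)"
      proof (intro order_trans[OF norm_sum] sum_mono)
        fix i :: 'z assume "i \<in> Basis"
        then have "\<bar>x \<bullet> i\<bar> * norm (blinfun_apply f i - \<sigma> i) \<le> norm x * e"
          using \<sigma>(2)[of i] by (intro mult_mono Basis_le_norm) auto
        then show "norm ((x \<bullet> i) *\<^sub>R (blinfun_apply f i - \<sigma> i)) \<le> norm x * e" by simp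
      qed
      finally show "norm (blinfun_apply (f - L (restrict \<sigma> Basis)) x) \<le> DIM('z) * e * norm x"
        by (simp add: ac_simps)
    qed (use e in simp)
    then have "dist f (L (restrict \<sigma> Basis)) < r" using e by (simp add: dist_norm)
    moreover have "restrict \<sigma> Basis \<in> Basis \<rightarrow>\<^sub>E D0" using \<sigma>(1) by auto
    ultimately show ?thesis by blast
  qed
  moreover have "countable (L ` (Basis \<rightarrow>\<^sub>E D0))"
    using D0(1) by (intro countable_image countable_PiE) auto
  ultimately show thesis using that by blast
qed

text \<open>The sum metric lies between the product distance and twice that distance. Continuity of
  the jet in the product topology, as in the hypotheses, can thus be used for the fibre
  metric.\<close>

lemma mtopology_of_jet_fibre_metric:
  "mtopology_of (jet_fibre_metric :: ('b::real_normed_vector \<times> ('z::real_normed_vector \<Rightarrow>\<^sub>L 'b)) metric) = euclidean"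
proof -
  let ?m = "jet_fibre_metric :: ('b \<times> ('z \<Rightarrow>\<^sub>L 'b)) metric"
  have ms: "Metric_space UNIV (mdist ?m)"
    using Metric_space_mspace_mdist[of ?m] by (simp only: mspace_jet_fibre_metric)
  have le: "dist x y \<le> mdist ?m x y" for x y
    by (cases x; cases y) (simp add: mdist_jet_fibre_metric dist_Pair_Pair sqrt_sum_squares_le_sum flip: dist_norm)
  have ge: "mdist ?m x y \<le> 2 * dist x y" for x y
    using dist_fst_le[of x y] dist_snd_le[of x y]
    by (cases x; cases y) (simp add: mdist_jet_fibre_metric dist_norm)
  show ?thesis
  proof (rule topology_eq[THEN iffD2], rule allI)
    fix U :: "('b \<times> ('z \<Rightarrow>\<^sub>L 'b)) set"
    have "openin (mtopology_of ?m) U \<longleftrightarrow> (\<forall>x\<in>U. \<exists>r>0. \<forall>y. mdist ?m x y < r \<longrightarrow> y \<in> U)"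
      unfolding mtopology_of_def mspace_jet_fibre_metric Metric_space.openin_mtopology[OF ms]
      by (simp add: subset_eq Ball_def Metric_space.in_mball[OF ms] del: split_paired_All)
    also have "\<dots> \<longleftrightarrow> (\<forall>x\<in>U. \<exists>r>0. \<forall>y. dist x y < r \<longrightarrow> y \<in> U)"
    proof (intro ball_cong refl iffI; elim exE conjE)
      fix x and r :: real assume r: "0 < r" "\<forall>y. mdist ?m x y < r \<longrightarrow> y \<in> U"
      have "y \<in> U" if "dist x y < r / 2" for y
      proof -
        have "mdist ?m x y < r" using that ge[of x y] by linarith
        then show ?thesis using r(2) by blast
      qed
      then show "\<exists>r>0. \<forall>y. dist x y < r \<longrightarrow> y \<in> U"
        using r(1) by (intro exI[of _ "r / 2"]) auto
    next
      fix x and r :: real assume r: "0 < r" "\<forall>y. dist x y < r \<longrightarrow> y \<in> U"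
      have "y \<in> U" if "mdist ?m x y < r" for y
      proof -
        have "dist x y < r" using that le[of x y] by linarith
        then show ?thesis using r(2) by blast
      qed
      then show "\<exists>r>0. \<forall>y. mdist ?m x y < r \<longrightarrow> y \<in> U"
        using r(1) by auto
    qed
    also have "\<dots> \<longleftrightarrow> openin euclidean U"
      by (simp add: open_dist dist_commute)
    finally show "openin (mtopology_of ?m) U \<longleftrightarrow> openin euclidean U" .
  qed
qed

section \<open>The modulus on the core and the pointwise remainder\<close>

lemma compact_closed_nbhd:
  fixes C :: "'a::heine_borel set"
  assumes "compact C" "0 < \<rho>" shows "compact (closed_nbhd C \<rho>)"
  using compact_infdist_le[OF _ assms] by (cases "C = {}") (auto simp: closed_nbhd_def)

lemma plus_in_closed_nbhd:
  fixes z u :: "'a::real_normed_vector"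
  assumes "z \<in> C" "norm u \<le> \<rho>" shows "z + u \<in> closed_nbhd C \<rho>"
  using assms infdist_le2[of z C "z + u" \<rho>] by (auto simp: closed_nbhd_def dist_norm)

lemma core_modulus_mono: "mono_on A (core_modulus K DF C R)"
  unfolding core_modulus_def by (intro mono_onI SUP_subset_mono) auto

lemma core_modulus_tendsto_0:
  fixes DF :: "'w::metric_space \<Rightarrow> 'z::euclidean_space \<Rightarrow> ('z \<Rightarrow>\<^sub>L 'b::real_normed_vector)"
  assumes K: "compact (K R)" and C: "compact C" and "0 < \<rho>"
    and cont: "continuous_on (K R \<times> closed_nbhd C \<rho>) (\<lambda>(x, z). DF x z)"
  shows "(core_modulus K DF C R \<longlongrightarrow> 0) (at_right 0)"
proof (rule order_tendstoI)
  fix e :: ennreal assume "0 < e"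
  then obtain r where r: "0 < r" "ennreal r < e"
    using dense[of 0 e] by (metis ennreal_cases ennreal_less_zero_iff less_top not_top_less)
  have "uniformly_continuous_on (K R \<times> closed_nbhd C \<rho>) (\<lambda>(x, z). DF x z)"
    using cont K C \<open>0 < \<rho>\<close> by (intro compact_uniformly_continuous compact_Times compact_closed_nbhd)
  then obtain d where d: "0 < d" "\<And>y z. y \<in> K R \<times> closed_nbhd C \<rho> \<Longrightarrow> z \<in> K R \<times> closed_nbhd C \<rho> \<Longrightarrow>
      dist z y < d \<Longrightarrow> dist (case z of (x, z) \<Rightarrow> DF x z) (case y of (x, z) \<Rightarrow> DF x z) < r"
    using r(1) unfolding uniformly_continuous_on_def by metis
  \<comment> \<open>The restriction \<delta> < \<rho> keeps z + u inside the compact neighbourhood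
    on which DF is uniformly continuous.\<close>
  have "core_modulus K DF C R \<delta> < e" if "\<delta> < min d \<rho>" for \<delta>
  proof -
    have "norm (DF x (z + u) - DF x z) \<le> r" if "x \<in> K R" "z \<in> C" "norm u \<le> \<delta>" for x z u
      using d(2)[of "(x, z)" "(x, z + u)"] that \<open>\<delta> < min d \<rho>\<close> \<open>0 < \<rho>\<close>
        plus_in_closed_nbhd[of z C u \<rho>] plus_in_closed_nbhd[of z C 0 \<rho>]
      by (auto simp: dist_Pair_Pair dist_norm)
    then have "core_modulus K DF C R \<delta> \<le> ennreal r"
      unfolding core_modulus_def by (intro SUP_least) (auto intro!: ennreal_leI)
    then show ?thesis using r(2) by simp
  qed
  moreover have "\<forall>\<^sub>F \<delta> in at_right 0. \<delta> < min d \<rho>"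
    using d(1) \<open>0 < \<rho>\<close> by (intro order_tendstoD[OF tendsto_ident_at]) auto
  ultimately show "\<forall>\<^sub>F \<delta> in at_right 0. core_modulus K DF C R \<delta> < e"
    by (auto elim: eventually_mono)
qed simp

text \<open>The mean value inequality on the segment from z to z + h. The bound b may be infinite,
  as the envelope can be at some points; then h \<noteq> 0 makes the right-hand side infinite too.
  One statement thus serves both on the core, with the modulus, and off it, with twice the
  envelope.\<close>

lemma linearization_remainder_le:
  fixes f :: "'z::real_normed_vector \<Rightarrow> 'b::real_normed_vector" and f' :: "'z \<Rightarrow> ('z \<Rightarrow>\<^sub>L 'b)"
  assumes deriv: "\<And>u. norm u \<le> norm h \<Longrightarrow> (f has_derivative blinfun_apply (f' (z + u))) (at (z + u))"
    and b: "\<And>u. norm u \<le> norm h \<Longrightarrow> ennreal (norm (f' (z + u) - f' z)) \<le> b" and "h \<noteq> 0"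
  shows "ennreal (norm (f (z + h) - f z - blinfun_apply (f' z) h)) \<le> ennreal (norm h) * b"
proof (cases b)
  case (real B)
  let ?S = "(\<lambda>t. z + t *\<^sub>R h) ` {0..1}"
  have S: "\<exists>u. norm u \<le> norm h \<and> x = z + u" if "x \<in> ?S" for x
  proof -
    obtain t where "x = z + t *\<^sub>R h" "t \<in> {0..1}" using \<open>x \<in> ?S\<close> by (rule imageE)
    then show ?thesis by (intro exI[of _ "t *\<^sub>R h"]) (simp add: mult_left_le_one_le)
  qed
  have "norm (f (z + h) - f z - blinfun_apply (f' z) (z + h - z)) \<le> norm (z + h - z) * B"
  proof (rule differentiable_bound_linearization[where S = ?S])
    fix x assume "x \<in> ?S"
    then obtain u where u: "norm u \<le> norm h" "x = z + u" using S by blast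
    show "(f has_derivative blinfun_apply (f' x)) (at x within ?S)"
      using deriv[OF u(1)] u(2) has_derivative_at_withinI by blast
    have "onorm (blinfun_apply (f' x) - blinfun_apply (f' z)) = norm (f' x - f' z)"
      by (simp add: norm_blinfun.rep_eq minus_blinfun.rep_eq fun_diff_def)
    then show "onorm (blinfun_apply (f' x) - blinfun_apply (f' z)) \<le> B"
      using b[OF u(1)] u(2) real by (simp add: ennreal_le_iff)
  next
    show "z \<in> ?S" by (auto intro!: image_eqI[of _ _ 0])
  qed auto
  then show ?thesis
    using real by (simp add: ennreal_leI flip: ennreal_mult)
qed (use \<open>h \<noteq> 0\<close> in \<open>simp add: ennreal_mult_top\<close>)

section \<open>Measurability of sections and the uniform remainder bound\<close>

lemma section_borel_measurable:
  fixes f :: "'w::topological_space \<Rightarrow> 'z::topological_space \<Rightarrow> 'e::topological_space"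
  assumes f: "(\<lambda>(x, z). f x z) \<in> borel_measurable (restrict_space borel (UNIV \<times> U))" and "z \<in> U"
  shows "(\<lambda>x. f x z) \<in> borel_measurable borel"
proof -
  have "(\<lambda>x. (x, z)) \<in> measurable borel (restrict_space borel (UNIV \<times> U))"
    using \<open>z \<in> U\<close> by (intro measurable_restrict_space2 borel_measurable_continuous_onI continuous_intros) auto
  from measurable_compose[OF this f] show ?thesis by simp
qed

lemma section_dist_measurable:
  fixes f :: "'w::topological_space \<Rightarrow> 'z::topological_space \<Rightarrow> 'e::metric_space"
  assumes "(\<lambda>(x, z). f x z) \<in> borel_measurable (restrict_space borel (UNIV \<times> U))" "z \<in> U"
  shows "(\<lambda>x. dist d (f x z)) \<in> borel_measurable borel"
  by (rule measurable_compose[OF section_borel_measurable[OF assms] borel_measurable_continuous_onI])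
    (intro continuous_intros)

lemma derivative_envelope_measurable:
  fixes DF :: "'w::topological_space \<Rightarrow> 'z::euclidean_space \<Rightarrow> ('z \<Rightarrow>\<^sub>L 'b::real_normed_vector)"
  assumes cont: "\<And>x. continuous_on U (DF x)"
    and meas: "(\<lambda>(x, z). DF x z) \<in> borel_measurable (restrict_space borel (UNIV \<times> U))"
    and U: "closed_nbhd C \<rho> \<subseteq> U"
  shows "derivative_envelope DF C \<rho> \<in> borel_measurable borel"
  unfolding derivative_envelope_def[abs_def]
proof (rule borel_measurable_SUP_continuous)
  show "continuous_on (closed_nbhd C \<rho>) (\<lambda>z. norm (DF x z))" for x
    using continuous_on_subset[OF cont U] by (intro continuous_intros)
  show "(\<lambda>x. norm (DF x z)) \<in> borel_measurable borel" if "z \<in> closed_nbhd C \<rho>" for z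
    using section_dist_measurable[OF meas, of z 0] U that by (auto simp: dist_norm)
qed

lemma nn_integral_envelope_le:
  assumes "P \<in> \<P>" "0 < q"
  shows "(\<integral>\<^sup>+x. enn_powr (derivative_envelope DF C \<rho> x) q \<partial>P) \<le> enn_powr (envelope_moment \<P> DF C \<rho> q) q"
proof -
  have "enn_powr (\<integral>\<^sup>+x. enn_powr (derivative_envelope DF C \<rho> x) q \<partial>P) (1 / q) \<le> envelope_moment \<P> DF C \<rho> q"
    unfolding envelope_moment_def using assms(1) by (rule SUP_upper)
  from enn_powr_mono[OF this, of q] show ?thesis
    using \<open>0 < q\<close> by (simp add: enn_powr_powr)
qed

lemma Lp_remainder_le:
  fixes F :: "'w::t2_space \<Rightarrow> 'z::euclidean_space \<Rightarrow> 'b::real_normed_vector"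
    and DF :: "'w \<Rightarrow> 'z \<Rightarrow> ('z \<Rightarrow>\<^sub>L 'b)"
  assumes \<P>: "\<P> \<subseteq> borel_prob_measures"
    and deriv: "\<And>x z. z \<in> U \<Longrightarrow> (F x has_derivative blinfun_apply (DF x z)) (at z)"
    and cont: "\<And>x. continuous_on U (DF x)"
    and meas: "(\<lambda>(x, z). DF x z) \<in> borel_measurable (restrict_space borel (UNIV \<times> U))"
    and U: "closed_nbhd C \<rho> \<subseteq> U" and K: "compact (K R)" and pq: "1 \<le> p" "p < q" and \<delta>: "\<delta> \<le> \<rho>"
  shows "Lp_remainder \<P> F DF C p \<delta> \<le> core_modulus K DF C R \<delta> +
    2 * envelope_moment \<P> DF C \<rho> q * enn_powr (core_defect \<P> K R) (1 / p - 1 / q)"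
  unfolding Lp_remainder_def
proof (rule SUP_least, clarsimp)
  fix P and z h :: 'z assume P: "P \<in> \<P>" and z: "z \<in> C" and h: "h \<noteq> 0" "norm h \<le> \<delta>"
  interpret prob_space P using P \<P> by (auto simp: borel_prob_measures_def)
  have sets_P [measurable_cong]: "sets P = sets borel" using P \<P> by (auto simp: borel_prob_measures_def)
  define H where "H = derivative_envelope DF C \<rho>"
  define b where "b = ennreal (norm h)"
  define \<omega> where "\<omega> = core_modulus K DF C R \<delta>"
  define M where "M = envelope_moment \<P> DF C \<rho> q"
  define \<tau> where "\<tau> = core_defect \<P> K R"
  define \<theta> where "\<theta> = 1 / p - 1 / q"
  define rem where "rem x = F x (z + h) - F x z - blinfun_apply (DF x z) h" for x
  have \<theta>: "0 \<le> \<theta>" using pq by (simp add: \<theta>_def field_simps)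
  have [measurable]: "H \<in> borel_measurable borel"
    unfolding H_def using cont meas U by (rule derivative_envelope_measurable)
  have A [measurable]: "- K R \<in> sets P"
    unfolding sets_P using K by (intro borel_open) (simp add: compact_imp_closed open_Compl)
  have nbhd: "z + u \<in> closed_nbhd C \<rho>" if "norm u \<le> norm h" for u :: 'z
    using that h z \<delta> by (intro plus_in_closed_nbhd) auto
  have der: "(F x has_derivative blinfun_apply (DF x (z + u))) (at (z + u))" if "norm u \<le> norm h" for x and u :: 'z
    using nbhd[OF that] U by (intro deriv) auto
  have on_core: "ennreal (norm (rem x)) \<le> b * \<omega>" if "x \<in> K R" for x
    unfolding rem_def b_def
  proof (rule linearization_remainder_le[OF der _ h(1)])
    fix u :: 'z assume "norm u \<le> norm h"
    then show "ennreal (norm (DF x (z + u) - DF x z)) \<le> \<omega>"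
      unfolding \<omega>_def core_modulus_def using that z h
      by (intro SUP_upper2[of "(x, z, u)"]) auto
  qed auto
  have off_core: "ennreal (norm (rem x)) \<le> b * (2 * H x)" for x
    unfolding rem_def b_def
  proof (rule linearization_remainder_le[OF der _ h(1)])
    fix u :: 'z assume u: "norm u \<le> norm h"
    have H: "ennreal (norm (DF x w)) \<le> H x" if "w \<in> closed_nbhd C \<rho>" for w
      unfolding H_def derivative_envelope_def using that by (rule SUP_upper)
    have "ennreal (norm (DF x (z + u) - DF x z)) \<le> ennreal (norm (DF x (z + u)) + norm (DF x z))"
      by (intro ennreal_leI norm_triangle_ineq4)
    also have "\<dots> \<le> H x + H x"
      using H[OF nbhd[OF u]] H[OF nbhd[of 0]] by (simp add: add_mono)
    finally show "ennreal (norm (DF x (z + u) - DF x z)) \<le> 2 * H x"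
      by (simp add: mult_2)
  qed auto
  have p: "0 < p" "0 < q" using pq by auto
  have "(\<integral>\<^sup>+x. ennreal (norm (rem x) powr p) \<partial>P)
      \<le> (\<integral>\<^sup>+x. enn_powr (b * \<omega>) p + enn_powr (b * 2) p * (enn_powr (H x) p * indicator (- K R) x) \<partial>P)"
  proof (rule nn_integral_mono)
    fix x
    show "ennreal (norm (rem x) powr p)
        \<le> enn_powr (b * \<omega>) p + enn_powr (b * 2) p * (enn_powr (H x) p * indicator (- K R) x)"
    proof (cases "x \<in> K R")
      case True
      then show ?thesis using ennreal_powr_le_enn_powr[OF on_core _ p(1)] by simp
    next
      case False
      have "ennreal (norm (rem x) powr p) \<le> enn_powr (b * 2) p * enn_powr (H x) p"
        using ennreal_powr_le_enn_powr[OF off_core[of x] _ p(1)] by (simp add: mult.assoc flip: enn_powr_mult)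
      then show ?thesis using False by (simp add: add_increasing)
    qed
  qed
  also have "\<dots> = enn_powr (b * \<omega>) p + enn_powr (b * 2) p * (\<integral>\<^sup>+x. enn_powr (H x) p * indicator (- K R) x \<partial>P)"
    by (simp add: nn_integral_add nn_integral_cmult emeasure_space_1)
  also have "\<dots> \<le> enn_powr (b * \<omega>) p + enn_powr (b * 2) p * enn_powr (M * enn_powr \<tau> \<theta>) p"
  proof (intro add_left_mono mult_left_mono)
    have "(\<integral>\<^sup>+x. enn_powr (H x) p * indicator (- K R) x \<partial>P)
        \<le> enn_powr (\<integral>\<^sup>+x. enn_powr (H x) q \<partial>P) (p / q) * enn_powr (emeasure P (- K R)) (1 - p / q)"
      using p pq by (intro nn_integral_enn_powr_set_le) (auto simp: less_top[symmetric])
    also have "\<dots> \<le> enn_powr (enn_powr M q) (p / q) * enn_powr \<tau> (1 - p / q)"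
      unfolding H_def M_def \<tau>_def core_defect_def using p pq P
      by (intro mult_mono enn_powr_mono nn_integral_envelope_le SUP_upper) auto
    \<comment> \<open>The exponents match since q * (p/q) = p and \<theta> * p = 1 - p/q.\<close>
    also have "\<dots> = enn_powr (M * enn_powr \<tau> \<theta>) p"
      using p by (simp add: enn_powr_mult enn_powr_powr \<theta>_def left_diff_distrib)
    finally show "(\<integral>\<^sup>+x. enn_powr (H x) p * indicator (- K R) x \<partial>P) \<le> enn_powr (M * enn_powr \<tau> \<theta>) p" .
  qed simp
  also have "\<dots> \<le> enn_powr (b * \<omega> + b * 2 * (M * enn_powr \<tau> \<theta>)) p"
    unfolding enn_powr_mult[symmetric] by (rule enn_powr_superadditive[OF pq(1)])
  finally have "Lp_norm p P rem \<le> enn_powr (enn_powr (b * \<omega> + b * 2 * (M * enn_powr \<tau> \<theta>)) p) (1 / p)"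
    unfolding Lp_norm_def using p by (intro enn_powr_mono) auto
  also have "\<dots> = (\<omega> + 2 * M * enn_powr \<tau> \<theta>) * b"
    using p by (simp add: enn_powr_powr algebra_simps)
  finally have "Lp_norm p P rem / b \<le> (\<omega> + 2 * M * enn_powr \<tau> \<theta>) * b / b"
    by (rule divide_right_mono_ennreal)
  also have "\<dots> = \<omega> + 2 * M * enn_powr \<tau> \<theta>"
    using h(1) by (intro mult_divide_eq_ennreal) (auto simp: b_def)
  finally show "Lp_norm p P (\<lambda>x. F x (z + h) - F x z - blinfun_apply (DF x z) h) / ennreal (norm h)
      \<le> core_modulus K DF C R \<delta> + 2 * envelope_moment \<P> DF C \<rho> q * enn_powr (core_defect \<P> K R) (1 / p - 1 / q)"
    by (simp add: rem_def[abs_def] b_def \<omega>_def M_def \<tau>_def \<theta>_def)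
qed

theorem theorem2p3:
  fixes \<P> :: "'w::polish_space measure set"
    and U C :: "(real ^ 'd::finite) set"
    and F :: "'w \<Rightarrow> real ^ 'd \<Rightarrow> 'b::{banach, second_countable_topology}"
    and DF :: "'w \<Rightarrow> real ^ 'd \<Rightarrow> ((real ^ 'd) \<Rightarrow>\<^sub>L 'b)"
    and K :: "nat \<Rightarrow> 'w set"
    and \<rho> p q :: real
  assumes "\<P> \<subseteq> borel_prob_measures"
    and "open U"
    and "(\<lambda>(x, z). F x z) \<in> borel_measurable (restrict_space borel (UNIV \<times> U))"
    and "\<And>x z. z \<in> U \<Longrightarrow> (F x has_derivative blinfun_apply (DF x z)) (at z)"
    and "\<And>x. continuous_on U (DF x)"
    and "(\<lambda>(x, z). DF x z) \<in> borel_measurable (restrict_space borel (UNIV \<times> U))"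
    and "compact_capacity_core \<P> K"
    and "compact C" and "C \<subseteq> U"
    and "0 < \<rho>" and "closed_nbhd C \<rho> \<subseteq> U"
    and "\<And>R. 1 \<le> R \<Longrightarrow> continuous_on (K R \<times> closed_nbhd C \<rho>) (\<lambda>(x, z). (F x z, DF x z))"
    and "1 \<le> p" and "p < q"
    and "envelope_moment \<P> DF C \<rho> q < \<infinity>"
  shows
    "(\<forall>R\<ge>1. mono_on {0<..\<rho>} (core_modulus K DF C R) \<and>
            (core_modulus K DF C R \<longlongrightarrow> 0) (at_right 0)) \<and>
     (\<forall>R\<ge>1. \<forall>\<delta>. 0 < \<delta> \<and> \<delta> \<le> \<rho> \<longrightarrow>
        Lp_remainder \<P> F DF C p \<delta> \<le>
          core_modulus K DF C R \<delta> +
          2 * envelope_moment \<P> DF C \<rho> q * enn_powr (core_defect \<P> K R) (1 / p - 1 / q)) \<and>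
     (Lp_remainder \<P> F DF C p \<longlongrightarrow> 0) (at_right 0) \<and>
     derivative_field DF C \<in> measurable borel (metric_borel (derivative_field_space C)) \<and>
     (\<forall>R\<ge>1. continuous_map (top_of_set (K R)) (mtopology_of (derivative_field_space C))
              (derivative_field DF C)) \<and>
     (\<forall>P\<in>\<P>. finite_moment (derivative_field_space C) p
              (law P (derivative_field_space C) (derivative_field DF C))) \<and>
     (\<forall>Pn P. (\<forall>n. Pn n \<in> \<P>) \<and> P \<in> \<P> \<and> weakly_converges Pn P \<longrightarrow>
        (\<lambda>n. wasserstein (derivative_field_space C) p
               (law (Pn n) (derivative_field_space C) (derivative_field DF C))
               (law P (derivative_field_space C) (derivative_field DF C))) \<longlonglongrightarrow> 0) \<and>
     ((SUP P\<in>\<P>. \<integral>\<^sup>+x. enn_powr (SUP z\<in>C. ennreal (norm (F x z) + norm (DF x z))) q \<partial>P) < \<infinity> \<longrightarrow>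
        jet_field F DF C \<in> measurable borel (metric_borel (jet_field_space C)) \<and>
        (\<forall>R\<ge>1. continuous_map (top_of_set (K R)) (mtopology_of (jet_field_space C))
                 (jet_field F DF C)) \<and>
        (\<forall>P\<in>\<P>. finite_moment (jet_field_space C) p
                 (law P (jet_field_space C) (jet_field F DF C))) \<and>
        (\<forall>Pn P. (\<forall>n. Pn n \<in> \<P>) \<and> P \<in> \<P> \<and> weakly_converges Pn P \<longrightarrow>
           (\<lambda>n. wasserstein (jet_field_space C) p
                  (law (Pn n) (jet_field_space C) (jet_field F DF C))
                  (law P (jet_field_space C) (jet_field F DF C))) \<longlonglongrightarrow> 0))"
proof (intro conjI impI allI ballI)

  \<comment> \<open>Remainder bound and its limit\<close>
  note \<P> = assms(1) and deriv = assms(4) and contDF = assms(5) and measF = assms(3) and measDF = assms(6)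
    and core = assms(7) and C = assms(8,9) and \<rho> = assms(10) and nbhd = assms(11) and jet = assms(12)
  have p: "0 < p" "0 < q" "p < q" using assms(13,14) by auto
  have K: "compact (K R)" if "1 \<le> R" for R
    using core that by (simp add: compact_capacity_core_def)
  have C_nbhd: "C \<subseteq> closed_nbhd C \<rho>"
    using plus_in_closed_nbhd[of _ C 0 \<rho>] \<rho> by auto
  have jetDF: "continuous_on (K R \<times> closed_nbhd C \<rho>) (\<lambda>(x, z). DF x z)" if "1 \<le> R" for R
    using continuous_on_snd[OF jet[OF that]] by (simp add: case_prod_beta')
  show "mono_on {0<..\<rho>} (core_modulus K DF C R)" for R
    by (rule core_modulus_mono)
  show modulus_0: "(core_modulus K DF C R \<longlongrightarrow> 0) (at_right 0)" if "1 \<le> R" for R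
    by (rule core_modulus_tendsto_0[where K = K and R = R and \<rho> = \<rho>, OF K[OF that] C(1) \<rho> jetDF[OF that]])
  define M where "M = envelope_moment \<P> DF C \<rho> q"
  define \<tau> where "\<tau> R = 2 * M * enn_powr (core_defect \<P> K R) (1 / p - 1 / q)" for R
  have bound: "Lp_remainder \<P> F DF C p \<delta> \<le> core_modulus K DF C R \<delta> + \<tau> R" if "1 \<le> R" "\<delta> \<le> \<rho>" for R \<delta>
    unfolding M_def \<tau>_def
    by (rule Lp_remainder_le[where K = K and R = R, OF \<P> deriv contDF measDF nbhd K[OF that(1)] assms(13,14) that(2)])
  show "Lp_remainder \<P> F DF C p \<delta> \<le> core_modulus K DF C R \<delta> +
      2 * envelope_moment \<P> DF C \<rho> q * enn_powr (core_defect \<P> K R) (1 / p - 1 / q)"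
    if "1 \<le> R" "0 < \<delta> \<and> \<delta> \<le> \<rho>" for R \<delta>
    using bound[of R \<delta>] that by (simp add: M_def \<tau>_def)
  have M: "2 * M < \<top>"
    using assms(15) by (simp add: M_def ennreal_mult_less_top)
  have \<theta>: "0 < 1 / p - 1 / q" using p by (simp add: field_simps)
  have "core_defect \<P> K \<longlonglongrightarrow> 0" using core by (simp add: compact_capacity_core_def)
  from ennreal_tendsto_cmult[OF M tendsto_enn_powr_0[OF this \<theta>]] have \<tau>: "\<tau> \<longlonglongrightarrow> 0"
    by (simp add: \<tau>_def[abs_def])
  show "(Lp_remainder \<P> F DF C p \<longlongrightarrow> 0) (at_right 0)"
  proof (rule order_tendstoI)
    fix e :: ennreal assume "0 < e"
    \<comment> \<open>R is fixed first, to make the tail term smaller than e; with this R the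
      modulus then vanishes as \<delta> decreases to 0.\<close>
    then have "\<forall>\<^sub>F R in sequentially. 1 \<le> R \<and> \<tau> R < e"
      using order_tendstoD(2)[OF \<tau>] by (intro eventually_conj eventually_ge_at_top)
    then obtain R where R: "1 \<le> R" "\<tau> R < e"
      by (auto simp: eventually_sequentially)
    have "((\<lambda>\<delta>. core_modulus K DF C R \<delta> + \<tau> R) \<longlongrightarrow> 0 + \<tau> R) (at_right 0)"
      by (intro tendsto_add modulus_0[OF R(1)] tendsto_const)
    then have "\<forall>\<^sub>F \<delta> in at_right 0. core_modulus K DF C R \<delta> + \<tau> R < e"
      using R(2) by (intro order_tendstoD) auto
    moreover have "\<forall>\<^sub>F \<delta> in at_right 0. \<delta> < \<rho>"
      using \<rho> by (intro order_tendstoD[OF tendsto_ident_at]) auto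
    ultimately show "\<forall>\<^sub>F \<delta> in at_right 0. Lp_remainder \<P> F DF C p \<delta> < e"
      by eventually_elim (use bound[OF R(1)] in \<open>auto intro: le_less_trans less_imp_le\<close>)
  qed simp

  \<comment> \<open>The derivative field\<close>
  obtain D0 :: "'b set" where D0: "countable D0" "\<And>x r. 0 < r \<Longrightarrow> \<exists>d\<in>D0. dist x d < r"
    by (rule countable_dense_points) blast
  obtain DL :: "((real ^ 'd) \<Rightarrow>\<^sub>L 'b) set" where DL: "countable DL" "\<And>f r. 0 < r \<Longrightarrow> \<exists>d\<in>DL. dist f d < r"
    by (rule countable_dense_blinfuns) blast
  have contDF_C: "continuous_on C (DF x)" for x
    using continuous_on_subset[OF contDF C(2)] .
  have contF_C: "continuous_on C (F x)" for x
    using C(2) by (intro continuous_at_imp_continuous_on ballI has_derivative_continuous[OF deriv]) auto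
  interpret D: random_field euclidean_metric C DF DL
    using C DL contDF_C by unfold_locales (auto intro!: section_dist_measurable[OF measDF])
  have D_field: "derivative_field DF C = D.field" and D_space: "derivative_field_space C = D.field_space"
    by (auto simp: derivative_field_def derivative_field_space_def)
  \<comment> \<open>Since C lies in its closed neighbourhood, the envelope based at 0 is dominated
    by H_C, so M_q already controls the moments of the derivative field.\<close>
  have D_envelope: "D.envelope 0 x \<le> derivative_envelope DF C \<rho> x" for x
    unfolding D.envelope_def derivative_envelope_def
    using C_nbhd by (auto intro!: SUP_subset_mono)
  have "(SUP P\<in>\<P>. \<integral>\<^sup>+x. enn_powr (D.envelope 0 x) q \<partial>P) \<le> enn_powr M q"
  proof (rule SUP_least)
    fix P assume P: "P \<in> \<P>"
    have "(\<integral>\<^sup>+x. enn_powr (D.envelope 0 x) q \<partial>P) \<le> (\<integral>\<^sup>+x. enn_powr (derivative_envelope DF C \<rho> x) q \<partial>P)"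
      using p D_envelope by (intro nn_integral_mono enn_powr_mono) auto
    also have "\<dots> \<le> enn_powr M q"
      unfolding M_def by (rule nn_integral_envelope_le[OF P p(2)])
    finally show "(\<integral>\<^sup>+x. enn_powr (D.envelope 0 x) q \<partial>P) \<le> enn_powr M q" .
  qed
  also have "\<dots> < \<infinity>" using assms(15) by (simp add: M_def)
  finally have D_moment: "(SUP P\<in>\<P>. \<integral>\<^sup>+x. enn_powr (D.envelope 0 x) q \<partial>P) < \<infinity>" .
  have D_core: "continuous_map (top_of_set (K R \<times> C)) (mtopology_of euclidean_metric) (\<lambda>(x, z). DF x z)"
    if "1 \<le> R" for R
    using continuous_on_subset[OF jetDF[OF that], of "K R \<times> C"] C_nbhd by auto
  show "derivative_field DF C \<in> measurable borel (metric_borel (derivative_field_space C))"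
    unfolding D_field D_space by (rule D.field_measurable)
  show "continuous_map (top_of_set (K R)) (mtopology_of (derivative_field_space C)) (derivative_field DF C)"
    if "1 \<le> R" for R
    unfolding D_field D_space by (rule D.field_continuous_map[OF K[OF that] D_core[OF that]])
  show "finite_moment (derivative_field_space C) p (law P (derivative_field_space C) (derivative_field DF C))"
    if "P \<in> \<P>" for P
    unfolding D_field D_space
    using \<P> that p le_less_trans[OF SUP_upper[OF that] D_moment]
    by (intro D.finite_moment_law[where a = 0 and q = q]) auto
  show "(\<lambda>n. wasserstein (derivative_field_space C) p
      (law (Pn n) (derivative_field_space C) (derivative_field DF C))
      (law P (derivative_field_space C) (derivative_field DF C))) \<longlonglongrightarrow> 0"
    if "(\<forall>n. Pn n \<in> \<P>) \<and> P \<in> \<P> \<and> weakly_converges Pn P" for Pn P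
    unfolding D_field D_space
    using that by (intro D.wasserstein_law_tendsto[OF \<P> core D_core p(1,3) D_moment]) auto

  \<comment> \<open>The first-jet field\<close>
  interpret J: random_field jet_fibre_metric C "\<lambda>x z. (F x z, DF x z)" "D0 \<times> DL"
  proof
    show "\<exists>d\<in>D0 \<times> DL. mdist jet_fibre_metric e d < r" if "0 < r" for e r
    proof -
      obtain b S where e: "e = (b, S)" by (cases e)
      have "0 < r / 2" using that by simp
      then obtain c T where "c \<in> D0" "dist b c < r / 2" "T \<in> DL" "dist S T < r / 2"
        using D0(2)[of "r / 2" b] DL(2)[of "r / 2" S] by blast
      then show ?thesis
        by (intro bexI[of _ "(c, T)"]) (auto simp: e mdist_jet_fibre_metric dist_norm)
    qed
    show "continuous_map (top_of_set C) (mtopology_of jet_fibre_metric) (\<lambda>z. (F x z, DF x z))" for x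
      unfolding mtopology_of_jet_fibre_metric using contF_C contDF_C by (auto intro!: continuous_intros)
    show "(\<lambda>x. mdist jet_fibre_metric d (F x z, DF x z)) \<in> borel_measurable borel" if "z \<in> C" for z d
    proof -
      obtain b S where d: "d = (b, S)" by (cases d)
      have "z \<in> U" using that C by auto
      then show ?thesis
        using section_dist_measurable[OF measF, of z b] section_dist_measurable[OF measDF, of z S]
        by (simp add: d mdist_jet_fibre_metric flip: dist_norm)
    qed
  qed (use C D0(1) DL(1) in auto)
  have J_field: "jet_field F DF C = J.field" and J_space: "jet_field_space C = J.field_space"
    by (auto simp: jet_field_def jet_field_space_def)
  have J_core: "continuous_map (top_of_set (K R \<times> C)) (mtopology_of jet_fibre_metric) (\<lambda>(x, z). (F x z, DF x z))"
    if "1 \<le> R" for R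
    unfolding mtopology_of_jet_fibre_metric
    using continuous_on_subset[OF jet[OF that], of "K R \<times> C"] C_nbhd by auto
  show "jet_field F DF C \<in> measurable borel (metric_borel (jet_field_space C))"
    unfolding J_field J_space by (rule J.field_measurable)
  show "continuous_map (top_of_set (K R)) (mtopology_of (jet_field_space C)) (jet_field F DF C)"
    if "1 \<le> R" for R
    unfolding J_field J_space by (rule J.field_continuous_map[OF K[OF that] J_core[OF that]])
  assume moment: "(SUP P\<in>\<P>. \<integral>\<^sup>+x. enn_powr (SUP z\<in>C. ennreal (norm (F x z) + norm (DF x z))) q \<partial>P) < \<infinity>"
  \<comment> \<open>With the sum norm on the fibre, the envelope based at (0, 0) is exactly the
    supremum in the additional moment hypothesis.\<close>
  have J_moment: "(SUP P\<in>\<P>. \<integral>\<^sup>+x. enn_powr (J.envelope (0, 0) x) q \<partial>P) < \<infinity>"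
    using moment by (simp add: J.envelope_def mdist_jet_fibre_metric)
  show "finite_moment (jet_field_space C) p (law P (jet_field_space C) (jet_field F DF C))"
    if "P \<in> \<P>" for P
    unfolding J_field J_space
    using \<P> that p le_less_trans[OF SUP_upper[OF that] J_moment]
    by (intro J.finite_moment_law[where a = "(0, 0)" and q = q]) auto
  show "(\<lambda>n. wasserstein (jet_field_space C) p
      (law (Pn n) (jet_field_space C) (jet_field F DF C))
      (law P (jet_field_space C) (jet_field F DF C))) \<longlonglongrightarrow> 0"
    if "(\<forall>n. Pn n \<in> \<P>) \<and> P \<in> \<P> \<and> weakly_converges Pn P" for Pn P
    unfolding J_field J_space
    using that by (intro J.wasserstein_law_tendsto[OF \<P> core J_core p(1,3) J_moment]) auto
qed

end
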